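(* Let $k\ge 0$ and $n\ge (k+1)^2$ be integers, and let $G$ be a nearly balanced bipartite graph on $2n-1$ vertices with minimum degree $\delta(G)\ge k$. (1) If $k\ge 1$ and $\rho(G)\ge\rho(S_n^k)$, then $G$ is traceable unless $G=S_n^k$. (2) If $k=0$, $n\ge 2$ and $\rho(G)\ge\rho(T_n^0)$, then $G$ is traceable unless $G=T_n^0$.
   Context: Graphs are finite and simple. A bipartite graph comes with a fixed bipartition $\{X,Y\}$ (parts may be empty); it is nearly balanced if the sizes of its two parts differ by exactly $1$ (the roles of the two parts may be interchanged). A graph is traceable if it contains a spanning path (Hamilton path). $\rho(G)$ is the spectral radius (largest eigenvalue of the adjacency matrix). Equality of graphs is up to isomorphism (possibly interchanging the two parts). $K_{m,n}$ is the complete bipartite graph with parts of sizes $|X|=m$, $|Y|=n$, and $\varPhi_{m,n}$ is the edgeless bipartite graph with parts of sizes $|X|=m$, $|Y|=n$. For bipartite graphs $G_1,G_2$ with bipartitions $\{X_1,Y_1\}$, $\{X_2,Y_2\}$, $G_1\sqcup G_2$ is the graph obtained from the disjoint union $G_1\cup G_2$ by adding all edges between $X_1$ and $Y_2$ and all edges between $Y_1$ and $X_2$ (its parts are $X_1\cup X_2$ and $Y_1\cup Y_2$). Define $S_n^k=K_{k,n-k-1}\sqcup\varPhi_{n-k,k}$ for $1\le k\le (n-1)/2$, and $T_n^k=K_{k,n-k-1}\sqcup\varPhi_{n-k-1,k+1}$ for $0\le k\le n/2-1$. *)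

theory Defs
  imports "Jordan_Normal_Form.Char_Poly" "HOL-Library.Countable_Set"
begin

(* An edge is an unordered pair, i.e. a two-element set of vertices. *)
record 'a bigraph =
  Xpart :: "'a set"
  Ypart :: "'a set"
  edges :: "'a set set"

definition verts :: "'a bigraph \<Rightarrow> 'a set" where
  "verts G = Xpart G \<union> Ypart G"

definition bipartite_graph :: "'a bigraph \<Rightarrow> bool" where
  "bipartite_graph G \<longleftrightarrow>
     finite (Xpart G) \<and> finite (Ypart G) \<and> Xpart G \<inter> Ypart G = {} \<and>
     edges G \<subseteq> {{x, y} | x y. x \<in> Xpart G \<and> y \<in> Ypart G}"

definition nearly_balanced :: "'a bigraph \<Rightarrow> bool" where
  "nearly_balanced G \<longleftrightarrow>
     card (Xpart G) = card (Ypart G) + 1 \<or> card (Ypart G) = card (Xpart G) + 1"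

definition vertex_degree :: "'a bigraph \<Rightarrow> 'a \<Rightarrow> nat" where
  "vertex_degree G v = card {u \<in> verts G. {u, v} \<in> edges G}"

(* Only meaningful for graphs with at least one vertex; likewise rho below. *)
definition min_degree :: "'a bigraph \<Rightarrow> nat" where
  "min_degree G = Min (vertex_degree G ` verts G)"

definition traceable :: "'a bigraph \<Rightarrow> bool" where
  "traceable G \<longleftrightarrow>
     (\<exists>p. p \<noteq> [] \<and> distinct p \<and> set p = verts G \<and>
          successively (\<lambda>u v. {u, v} \<in> edges G) p)"

(* For finite V, from_nat_into V restricts to a bijection from {..<card V} onto V.
   Another enumeration of the vertices would permute rows and columns simultaneously,
   which does not affect the eigenvalues. *)
definition adjacency_matrix :: "'a bigraph \<Rightarrow> real mat" where
  "adjacency_matrix G =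
     (let V = verts G; w = from_nat_into V in
      mat (card V) (card V) (\<lambda>(i, j). if {w i, w j} \<in> edges G then 1 else 0))"

definition rho :: "'a bigraph \<Rightarrow> real" where
  "rho G = Max {l. eigenvalue (adjacency_matrix G) l}"

(* The vertex bijection may interchange the two parts. *)
definition bigraph_iso :: "'a bigraph \<Rightarrow> 'b bigraph \<Rightarrow> bool" (infix "\<cong>\<^sub>b" 50) where
  "G \<cong>\<^sub>b H \<longleftrightarrow>
     (\<exists>f. bij_betw f (verts G) (verts H) \<and>
          (f ` Xpart G = Xpart H \<and> f ` Ypart G = Ypart H \<or>
           f ` Xpart G = Ypart H \<and> f ` Ypart G = Xpart H) \<and>
          (\<forall>u \<in> verts G. \<forall>v \<in> verts G. {u, v} \<in> edges G \<longleftrightarrow> {f u, f v} \<in> edges H))"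

definition complete_bip :: "nat \<Rightarrow> nat \<Rightarrow> (nat + nat) bigraph" where
  "complete_bip m n =
     \<lparr>Xpart = Inl ` {..<m}, Ypart = Inr ` {..<n},
      edges = {{Inl i, Inr j} | i j. i < m \<and> j < n}\<rparr>"

definition edgeless_bip :: "nat \<Rightarrow> nat \<Rightarrow> (nat + nat) bigraph" where
  "edgeless_bip m n = \<lparr>Xpart = Inl ` {..<m}, Ypart = Inr ` {..<n}, edges = {}\<rparr>"

definition bip_join :: "'a bigraph \<Rightarrow> 'b bigraph \<Rightarrow> ('a + 'b) bigraph" (infixl "\<squnion>\<^sub>b" 65) where
  "G \<squnion>\<^sub>b H =
     \<lparr>Xpart = Xpart G <+> Xpart H, Ypart = Ypart G <+> Ypart H,
      edges = (`) Inl ` edges G \<union> (`) Inr ` edges H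
        \<union> {{Inl x, Inr y} | x y. x \<in> Xpart G \<and> y \<in> Ypart H}
        \<union> {{Inl y, Inr x} | y x. y \<in> Ypart G \<and> x \<in> Xpart H}\<rparr>"

(* Intended for 1 \<le> k \<le> (n - 1) / 2, where no subtraction truncates. *)
definition S_graph :: "nat \<Rightarrow> nat \<Rightarrow> ((nat + nat) + (nat + nat)) bigraph" where
  "S_graph n k = complete_bip k (n - k - 1) \<squnion>\<^sub>b edgeless_bip (n - k) k"

(* Intended for 0 \<le> k \<le> n / 2 - 1, where no subtraction truncates. *)
definition T_graph :: "nat \<Rightarrow> nat \<Rightarrow> ((nat + nat) + (nat + nat)) bigraph" where
  "T_graph n k = complete_bip k (n - k - 1) \<squnion>\<^sub>b edgeless_bip (n - k - 1) (k + 1)"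

end

theory Submission
  imports Defs "Jordan_Normal_Form.Spectral_Radius"
begin

text \<open>Let the parts have sizes \<open>n\<close> and \<open>n - 1\<close>. By Cauchy-Schwarz
  \<open>\<rho>(G)\<^sup>2\<close> is at most the number of edges, so the spectral hypothesis leaves fewer than \<open>n k\<close>
  non-edges (at most \<open>n - 1\<close> if \<open>k = 0\<close>). If \<open>G\<close> is not traceable, extend it to an
  edge-maximal non-traceable \<open>H\<close> on the same parts. By rerouting Hamilton paths, non-adjacent
  vertices of \<open>H\<close> in different parts have degree sum at most \<open>n - 1\<close>. For a non-adjacent pair
  with maximal degree sum, with degree \<open>s\<close> on the larger side, this gives at least
  \<open>(s + 1) (n - 1 - s)\<close> non-edges. As this product is concave in \<open>s\<close>, only the
  extreme values of \<open>s\<close> survive, and they force \<open>H\<close> to be \<open>S\<close> or \<open>T\<close>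
  (or, for \<open>k = 0\<close>, the graph \<open>S\<close> with parameter 1, whose spectral radius is less
  than \<open>n - 1\<close>). Finally, deleting an edge from the connected graph \<open>S\<close> strictly lowers
  the spectral radius, so \<open>G = H\<close>.\<close>

section \<open>Eigenvalues as eigenfunctions\<close>

text \<open>Eigenvectors are indexed by vertices instead of matrix positions, so later arguments do
  not depend on the enumeration \<open>from_nat_into\<close>. Values of \<open>f\<close> outside
  \<open>verts G\<close> do not matter.\<close>

definition eigenfunction :: "'a bigraph \<Rightarrow> real \<Rightarrow> ('a \<Rightarrow> real) \<Rightarrow> bool" where
  "eigenfunction G l f \<longleftrightarrow> (\<exists>v\<in>verts G. f v \<noteq> 0) \<and>
     (\<forall>u\<in>verts G. (\<Sum>v\<in>verts G. if {u, v} \<in> edges G then f v else 0) = l * f u)"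

lemma eigenvalue_adjacency_iff:
  fixes G :: "'a bigraph"
  assumes fin: "finite (verts G)"
  shows "eigenvalue (adjacency_matrix G) l \<longleftrightarrow> (\<exists>f. eigenfunction G l f)"
proof -
  define V where "V = verts G"
  define n where "n = card V"
  define w where "w = from_nat_into V"
  define A where "A = adjacency_matrix G"
  have A: "A = mat n n (\<lambda>(i, j). if {w i, w j} \<in> edges G then 1 else 0)"
    by (simp add: A_def adjacency_matrix_def V_def n_def w_def Let_def)
  have Ac: "A \<in> carrier_mat n n" by (simp add: A)
  have finV: "finite V" using fin by (simp add: V_def)
  have w: "bij_betw w {..<n} V"
    unfolding w_def n_def using bij_betw_from_nat_into_finite[OF finV] by (simp add: lessThan_atLeast0)
  have row: "(A *\<^sub>v v) $ i = (\<Sum>j<n. if {w i, w j} \<in> edges G then v $ j else 0)"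
    if "v \<in> carrier_vec n" "i < n" for v i
  proof -
    have "(A *\<^sub>v v) $ i = (\<Sum>j<n. (if {w i, w j} \<in> edges G then 1 else 0) * v $ j)"
      using that by (simp add: A scalar_prod_def lessThan_atLeast0)
    also have "\<dots> = (\<Sum>j<n. if {w i, w j} \<in> edges G then v $ j else 0)"
      by (intro sum.cong) auto
    finally show ?thesis .
  qed
  have reindex: "(\<Sum>j<n. if {u, w j} \<in> edges G then f (w j) else 0) =
      (\<Sum>v\<in>V. if {u, v} \<in> edges G then f v else 0)" for u and f :: "'a \<Rightarrow> real"
    using sum.reindex_bij_betw[OF w, of "\<lambda>v. if {u, v} \<in> edges G then f v else 0"] .
  have win: "i < n \<Longrightarrow> w i \<in> V" for i using w by (auto simp: bij_betw_def)
  show ?thesis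
  proof
    assume "eigenvalue (adjacency_matrix G) l"
    then obtain v where v: "v \<in> carrier_vec n" "v \<noteq> 0\<^sub>v n" "A *\<^sub>v v = l \<cdot>\<^sub>v v"
      using Ac by (auto simp: eigenvalue_def eigenvector_def A_def)
    define f where "f u = v $ (inv_into {..<n} w u)" for u
    have fw: "f (w i) = v $ i" if "i < n" for i
      using w that by (simp add: f_def bij_betw_def)
    obtain i where i: "i < n" "v $ i \<noteq> 0"
      using v(1,2) by (metis carrier_vecD eq_vecI index_zero_vec)
    have "\<exists>v\<in>V. f v \<noteq> 0" using i fw win by force
    moreover have "(\<Sum>v\<in>V. if {u, v} \<in> edges G then f v else 0) = l * f u" if "u \<in> V" for u
    proof -
      have "u \<in> w ` {..<n}" using bij_betw_imp_surj_on[OF w] that by simp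
      then obtain i where i: "i < n" "u = w i" by auto
      have "(\<Sum>v\<in>V. if {u, v} \<in> edges G then f v else 0) = (A *\<^sub>v v) $ i"
        unfolding row[OF v(1) i(1)] reindex[symmetric] i(2)
        by (intro sum.cong) (auto simp: fw)
      also have "\<dots> = l * f u" using i v fw by simp
      finally show ?thesis .
    qed
    ultimately show "\<exists>f. eigenfunction G l f" by (auto simp: eigenfunction_def V_def)
  next
    assume "\<exists>f. eigenfunction G l f"
    then obtain f where f: "\<exists>v\<in>V. f v \<noteq> 0"
      "\<And>u. u \<in> V \<Longrightarrow> (\<Sum>v\<in>V. if {u, v} \<in> edges G then f v else 0) = l * f u"
      by (auto simp: eigenfunction_def V_def)
    define v where "v = vec n (\<lambda>i. f (w i))"
    have v: "v \<in> carrier_vec n" by (simp add: v_def)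
    obtain i where "i < n" "f (w i) \<noteq> 0" using f(1) w by (auto simp: bij_betw_def)
    then have "v $ i \<noteq> 0\<^sub>v n $ i" by (simp add: v_def)
    then have "v \<noteq> 0\<^sub>v n" by metis
    moreover have "A *\<^sub>v v = l \<cdot>\<^sub>v v"
    proof (rule eq_vecI)
      fix i assume "i < dim_vec (l \<cdot>\<^sub>v v)"
      then have i: "i < n" by (simp add: v_def)
      have "(A *\<^sub>v v) $ i = (\<Sum>j<n. if {w i, w j} \<in> edges G then f (w j) else 0)"
        unfolding row[OF v i] by (intro sum.cong) (auto simp: v_def)
      also have "\<dots> = l * f (w i)" unfolding reindex using f(2) win i by simp
      finally show "(A *\<^sub>v v) $ i = (l \<cdot>\<^sub>v v) $ i" using i by (simp add: v_def)
    qed (simp add: A v_def)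
    ultimately show "eigenvalue (adjacency_matrix G) l"
      using v Ac by (auto simp: eigenvalue_def eigenvector_def A_def)
  qed
qed

text \<open>Over the complex numbers an eigenvalue always exists; symmetry makes it real, hence a
  root of the real characteristic polynomial. This is what makes the set under \<open>Max\<close> in
  \<open>rho_def\<close> nonempty.\<close>

lemma symmetric_real_mat_eigenvalue_exists:
  fixes A :: "real mat"
  assumes A: "A \<in> carrier_mat n n" and n: "n > 0"
    and sym: "\<And>i j. i < n \<Longrightarrow> j < n \<Longrightarrow> A $$ (i, j) = A $$ (j, i)"
  shows "\<exists>l. eigenvalue A l"
proof -
  define B :: "complex mat" where "B = map_mat of_real A"
  have B: "B \<in> carrier_mat n n" using A by (simp add: B_def)
  obtain c where c: "eigenvalue B c"
    using spectrum_non_empty[OF B n] by (auto simp: spectrum_def)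
  then obtain v where v: "v \<in> carrier_vec n" "v \<noteq> 0\<^sub>v n" "B *\<^sub>v v = c \<cdot>\<^sub>v v"
    using B by (auto simp: eigenvalue_def eigenvector_def)
  have row: "(\<Sum>j<n. of_real (A $$ (i, j)) * v $ j) = c * v $ i" if "i < n" for i
  proof -
    have "(\<Sum>j<n. of_real (A $$ (i, j)) * v $ j) = (B *\<^sub>v v) $ i"
      using that v(1) A by (simp add: B_def scalar_prod_def lessThan_atLeast0)
    then show ?thesis using v(1,3) that by simp
  qed
  \<comment> \<open>\<open>q\<close> is the Hermitian form of \<open>B\<close> at \<open>v\<close>:
    the eigenvalue equation evaluates it as \<open>c\<close> times the squared norm of
    \<open>v\<close>, and symmetry of \<open>A\<close> gives \<open>cnj q = q\<close>.\<close>
  define q where "q = (\<Sum>i<n. \<Sum>j<n. cnj (v $ i) * (of_real (A $$ (i, j)) * v $ j))"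
  have q1: "q = c * of_real (\<Sum>i<n. (cmod (v $ i))\<^sup>2)"
  proof -
    have "q = (\<Sum>i<n. cnj (v $ i) * (c * v $ i))"
      unfolding q_def sum_distrib_left[symmetric] by (intro sum.cong) (simp_all add: row)
    also have "\<dots> = (\<Sum>i<n. c * of_real ((cmod (v $ i))\<^sup>2))"
      by (intro sum.cong) (simp_all add: complex_norm_square[symmetric] mult_ac)
    finally show ?thesis by (simp add: sum_distrib_left)
  qed
  have "cnj q = (\<Sum>i<n. \<Sum>j<n. cnj (v $ j) * (of_real (A $$ (j, i)) * v $ i))"
    unfolding q_def by (simp add: mult_ac sym cong: sum.cong_simp)
  also have "\<dots> = q" unfolding q_def by (rule sum.swap)
  finally have "cnj q = q" .
  moreover have "(\<Sum>i<n. (cmod (v $ i))\<^sup>2) \<noteq> 0"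
  proof -
    obtain i where "i < n" "v $ i \<noteq> 0"
      using v(1,2) by (metis carrier_vecD eq_vecI index_zero_vec)
    then have "(\<Sum>i<n. (cmod (v $ i))\<^sup>2) > 0" by (intro sum_pos2[of _ i]) auto
    then show ?thesis by simp
  qed
  ultimately have "cnj c = c"
    unfolding q1 complex_cnj_mult complex_cnj_complex_of_real mult_cancel_right of_real_eq_0_iff by blast
  then have cr: "c = of_real (Re c)" by (metis Reals_cnj_iff of_real_Re)
  have "poly (char_poly B) c = 0" using c eigenvalue_root_char_poly[OF B] by simp
  then have "poly (map_poly of_real (char_poly A)) (of_real (Re c) :: complex) = 0"
    unfolding cr[symmetric] B_def of_real_hom.char_poly_hom[OF A] .
  then have "poly (char_poly A) (Re c) = 0" by simp
  then show ?thesis using eigenvalue_root_char_poly[OF A] by auto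
qed

text \<open>\<open>Max\<close> is informative only on a finite nonempty set: the spectrum is finite,
  and it is nonempty for a graph with a vertex because the adjacency matrix is symmetric.\<close>

lemma
  fixes G :: "'a bigraph"
  assumes fin: "finite (verts G)"
  shows rho_eigenvalue: "verts G \<noteq> {} \<Longrightarrow> \<exists>f. eigenfunction G (rho G) f"
    and rho_upper: "eigenfunction G l f \<Longrightarrow> l \<le> rho G"
proof -
  define A where "A = adjacency_matrix G"
  define n where "n = card (verts G)"
  have A: "A \<in> carrier_mat n n"
    by (simp add: A_def adjacency_matrix_def n_def Let_def)
  have sym: "A $$ (i, j) = A $$ (j, i)" if "i < n" "j < n" for i j
    using that by (simp add: A_def adjacency_matrix_def n_def Let_def insert_commute)
  have finE: "finite {l. eigenvalue A l}"
    using card_finite_spectrum(1)[OF A] by (simp add: spectrum_def)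
  show "\<exists>f. eigenfunction G (rho G) f" if "verts G \<noteq> {}"
  proof -
    have "n > 0" using that fin by (simp add: n_def card_gt_0_iff)
    then have "{l. eigenvalue A l} \<noteq> {}"
      using symmetric_real_mat_eigenvalue_exists[OF A _ sym] by auto
    from Max_in[OF finE this] show ?thesis
      using eigenvalue_adjacency_iff[OF fin] by (auto simp: rho_def A_def)
  qed
  show "l \<le> rho G" if "eigenfunction G l f"
  proof -
    have "l \<in> {l. eigenvalue A l}"
      using that eigenvalue_adjacency_iff[OF fin] by (auto simp: A_def)
    from Max_ge[OF finE this] show ?thesis by (simp add: rho_def A_def)
  qed
qed

section \<open>Eigenvalue equations of bipartite graphs and the edge bound\<close>

lemma bipartite_edgeD:
  assumes "bipartite_graph G" "{u, v} \<in> edges G"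
  shows "u \<in> Xpart G \<and> v \<in> Ypart G \<or> u \<in> Ypart G \<and> v \<in> Xpart G"
  using assms by (fastforce simp: bipartite_graph_def doubleton_eq_iff)

lemma bipartite_edges_eqI:
  assumes "bipartite_graph G" "bipartite_graph H"
    and "Xpart H = Xpart G" "Ypart H = Ypart G"
    and "\<And>x y. x \<in> Xpart G \<Longrightarrow> y \<in> Ypart G \<Longrightarrow> {x, y} \<in> edges G \<longleftrightarrow> {x, y} \<in> edges H"
  shows "edges G = edges H"
proof -
  have "e \<in> edges G \<longleftrightarrow> e \<in> edges H" for e
  proof (cases "\<exists>x\<in>Xpart G. \<exists>y\<in>Ypart G. e = {x, y}")
    case True
    then show ?thesis using assms(5) by auto
  next
    case False
    then have "e \<notin> edges G" "e \<notin> edges H"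
      using assms(1-4) unfolding bipartite_graph_def by blast+
    then show ?thesis by simp
  qed
  then show ?thesis by auto
qed

text \<open>Edges are oriented from \<open>Xpart\<close> to \<open>Ypart\<close>, so that double
  sums over the two parts count each edge once.\<close>

definition edge_pairs :: "'a bigraph \<Rightarrow> ('a \<times> 'a) set" where
  "edge_pairs G = {(x, y). x \<in> Xpart G \<and> y \<in> Ypart G \<and> {x, y} \<in> edges G}"

lemma eigenfunction_bipartite:
  assumes G: "bipartite_graph G" and f: "eigenfunction G l f"
  shows "x \<in> Xpart G \<Longrightarrow> (\<Sum>y\<in>Ypart G. if {x, y} \<in> edges G then f y else 0) = l * f x"
    and "y \<in> Ypart G \<Longrightarrow> (\<Sum>x\<in>Xpart G. if {x, y} \<in> edges G then f x else 0) = l * f y"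
proof -
  have fin: "finite (verts G)" and disj: "Xpart G \<inter> Ypart G = {}"
    using G by (auto simp: bipartite_graph_def verts_def)
  show "(\<Sum>y\<in>Ypart G. if {x, y} \<in> edges G then f y else 0) = l * f x" if x: "x \<in> Xpart G"
  proof -
    have "(\<Sum>y\<in>Ypart G. if {x, y} \<in> edges G then f y else 0) =
        (\<Sum>y\<in>verts G. if {x, y} \<in> edges G then f y else 0)"
      using fin x disj bipartite_edgeD[OF G, of x]
      by (intro sum.mono_neutral_left) (auto simp: verts_def)
    then show ?thesis using f x by (simp add: eigenfunction_def verts_def)
  qed
  show "(\<Sum>x\<in>Xpart G. if {x, y} \<in> edges G then f x else 0) = l * f y" if y: "y \<in> Ypart G"
  proof -
    have "(\<Sum>x\<in>Xpart G. if {x, y} \<in> edges G then f x else 0) =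
        (\<Sum>x\<in>verts G. if {y, x} \<in> edges G then f x else 0)"
      unfolding insert_commute[of y] using fin y disj bipartite_edgeD[OF G, of _ y]
      by (intro sum.mono_neutral_left) (auto simp: verts_def)
    then show ?thesis using f y by (simp add: eigenfunction_def verts_def)
  qed
qed

lemma eigenfunction_bipartiteI:
  assumes G: "bipartite_graph G" and nz: "\<exists>v\<in>verts G. f v \<noteq> 0"
    and X: "\<And>x. x \<in> Xpart G \<Longrightarrow> (\<Sum>y\<in>Ypart G. if {x, y} \<in> edges G then f y else 0) = l * f x"
    and Y: "\<And>y. y \<in> Ypart G \<Longrightarrow> (\<Sum>x\<in>Xpart G. if {x, y} \<in> edges G then f x else 0) = l * f y"
  shows "eigenfunction G l f"
proof -
  have fin: "finite (verts G)" and disj: "Xpart G \<inter> Ypart G = {}"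
    using G by (auto simp: bipartite_graph_def verts_def)
  have "(\<Sum>y\<in>verts G. if {x, y} \<in> edges G then f y else 0) = l * f x" if x: "x \<in> Xpart G" for x
  proof -
    have "(\<Sum>y\<in>Ypart G. if {x, y} \<in> edges G then f y else 0) =
        (\<Sum>y\<in>verts G. if {x, y} \<in> edges G then f y else 0)"
      using fin x disj bipartite_edgeD[OF G, of x]
      by (intro sum.mono_neutral_left) (auto simp: verts_def)
    then show ?thesis using X[OF x] by simp
  qed
  moreover have "(\<Sum>x\<in>verts G. if {y, x} \<in> edges G then f x else 0) = l * f y"
    if y: "y \<in> Ypart G" for y
  proof -
    have "(\<Sum>x\<in>Xpart G. if {x, y} \<in> edges G then f x else 0) =
        (\<Sum>x\<in>verts G. if {y, x} \<in> edges G then f x else 0)"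
      unfolding insert_commute[of y] using fin y disj bipartite_edgeD[OF G, of _ y]
      by (intro sum.mono_neutral_left) (auto simp: verts_def)
    then show ?thesis using Y[OF y] by simp
  qed
  ultimately show ?thesis using nz by (auto simp: eigenfunction_def verts_def)
qed

lemma sum_of_bool_edges:
  assumes "bipartite_graph G"
  shows "(\<Sum>x\<in>Xpart G. \<Sum>y\<in>Ypart G. of_bool ({x, y} \<in> edges G)) = real (card (edge_pairs G))"
proof -
  have "edge_pairs G = {p \<in> Xpart G \<times> Ypart G. case p of (x, y) \<Rightarrow> {x, y} \<in> edges G}"
    by (auto simp: edge_pairs_def)
  then have "real (card (edge_pairs G)) = (\<Sum>(x, y)\<in>Xpart G \<times> Ypart G. of_bool ({x, y} \<in> edges G))"
    using assms by (simp add: bipartite_graph_def sum.If_cases of_bool_def case_prod_unfold Int_def)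
  then show ?thesis by (simp add: sum.cartesian_product)
qed

text \<open>Lagrange's identity: the difference of the two sides is half the sum of the squares
  \<open>(a i * b j - a j * b i)^2\<close>.\<close>

lemma Cauchy_Schwarz_sum:
  fixes a b :: "'b \<Rightarrow> real"
  shows "(\<Sum>i\<in>I. a i * b i)\<^sup>2 \<le> (\<Sum>i\<in>I. (a i)\<^sup>2) * (\<Sum>i\<in>I. (b i)\<^sup>2)"
proof -
  have "0 \<le> (\<Sum>i\<in>I. \<Sum>j\<in>I. (a i * b j - a j * b i)\<^sup>2)" by (intro sum_nonneg) auto
  also have "\<dots> = (\<Sum>i\<in>I. \<Sum>j\<in>I. (a i)\<^sup>2 * (b j)\<^sup>2 + (b i)\<^sup>2 * (a j)\<^sup>2 - 2 * ((a i * b i) * (a j * b j)))"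
    by (intro sum.cong) (auto simp: power2_eq_square algebra_simps)
  also have "\<dots> = (\<Sum>i\<in>I. (a i)\<^sup>2) * (\<Sum>i\<in>I. (b i)\<^sup>2) + (\<Sum>i\<in>I. (b i)\<^sup>2) * (\<Sum>i\<in>I. (a i)\<^sup>2)
      - 2 * ((\<Sum>i\<in>I. a i * b i) * (\<Sum>i\<in>I. a i * b i))"
    unfolding sum_product by (simp add: sum.distrib sum_subtractf sum_distrib_left)
  finally show ?thesis by (simp add: power2_eq_square)
qed

text \<open>Cauchy-Schwarz in the eigenvalue equation at \<open>x\<close> bounds
  \<open>(l * f x)^2\<close> by the degree of \<open>x\<close> times the squared norm of
  \<open>f\<close> on the other part. The degrees in one part sum to the number of edges.\<close>

lemma eigenvalue_square_le_edges:
  fixes G :: "'a bigraph"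
  assumes G: "bipartite_graph G" and f: "eigenfunction G l f"
  shows "l\<^sup>2 \<le> real (card (edge_pairs G))"
proof -
  define e where "e = real (card (edge_pairs G))"
  define a :: "'a \<Rightarrow> 'a \<Rightarrow> real" where "a x y = of_bool ({x, y} \<in> edges G)" for x y
  have fin: "finite (Xpart G)" "finite (Ypart G)" and disj: "Xpart G \<inter> Ypart G = {}"
    using G by (auto simp: bipartite_graph_def)
  have a2: "(a x y)\<^sup>2 = a x y" for x y by (simp add: a_def)
  have e1: "(\<Sum>x\<in>Xpart G. \<Sum>y\<in>Ypart G. a x y) = e"
    using sum_of_bool_edges[OF G] by (simp add: a_def e_def)
  have e2: "(\<Sum>y\<in>Ypart G. \<Sum>x\<in>Xpart G. a x y) = e"
    using e1 by (subst sum.swap)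
  have aif: "(if {x, y} \<in> edges G then c else 0) = a x y * c" for x y c by (simp add: a_def)
  have "(\<Sum>x\<in>Xpart G. (l * f x)\<^sup>2) \<le> (\<Sum>x\<in>Xpart G. (\<Sum>y\<in>Ypart G. a x y) * (\<Sum>y\<in>Ypart G. (f y)\<^sup>2))"
    by (intro sum_mono) (use Cauchy_Schwarz_sum[of "a _" f "Ypart G"] in
      \<open>simp add: eigenfunction_bipartite(1)[OF G f, symmetric] aif a2\<close>)
  then have X: "l\<^sup>2 * (\<Sum>x\<in>Xpart G. (f x)\<^sup>2) \<le> e * (\<Sum>y\<in>Ypart G. (f y)\<^sup>2)"
    by (simp add: power_mult_distrib sum_distrib_left[symmetric] sum_distrib_right[symmetric] e1)
  have "(\<Sum>y\<in>Ypart G. (l * f y)\<^sup>2) \<le> (\<Sum>y\<in>Ypart G. (\<Sum>x\<in>Xpart G. a x y) * (\<Sum>x\<in>Xpart G. (f x)\<^sup>2))"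
    by (intro sum_mono) (use Cauchy_Schwarz_sum[of "\<lambda>x. a x _" f "Xpart G"] in
      \<open>simp add: eigenfunction_bipartite(2)[OF G f, symmetric] aif a2\<close>)
  then have Y: "l\<^sup>2 * (\<Sum>y\<in>Ypart G. (f y)\<^sup>2) \<le> e * (\<Sum>x\<in>Xpart G. (f x)\<^sup>2)"
    by (simp add: power_mult_distrib sum_distrib_left[symmetric] sum_distrib_right[symmetric] e2)
  \<comment> \<open>Adding \<open>X\<close> and \<open>Y\<close> puts the squared norm
    \<open>N\<close> of \<open>f\<close> on both sides, where it cancels.\<close>
  define N where "N = (\<Sum>x\<in>Xpart G. (f x)\<^sup>2) + (\<Sum>y\<in>Ypart G. (f y)\<^sup>2)"
  have "N = (\<Sum>v\<in>verts G. (f v)\<^sup>2)"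
    unfolding N_def verts_def using fin disj by (simp add: sum.union_disjoint)
  moreover obtain v where "v \<in> verts G" "f v \<noteq> 0" using f by (auto simp: eigenfunction_def)
  then have "0 < (\<Sum>v\<in>verts G. (f v)\<^sup>2)" using fin by (intro sum_pos2[of _ v]) (auto simp: verts_def)
  ultimately have "N > 0" by simp
  moreover have "l\<^sup>2 * N \<le> e * N" using X Y by (simp add: N_def algebra_simps)
  ultimately show ?thesis by (simp add: e_def)
qed

section \<open>Perron-Frobenius comparison with a supergraph\<close>

text \<open>Pointwise, \<open>abs l\<close> times the absolute value of \<open>f\<close> is at most
  the neighbour sum of that absolute value in \<open>G\<close>, hence at most the one in
  \<open>H\<close>. Pairing with the positive eigenfunction \<open>z\<close> of \<open>H\<close>
  yields the bound by \<open>m\<close>; if \<open>l = m\<close>, all these inequalities are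
  tight.\<close>

lemma eigenfunction_compare:
  fixes G H :: "'a bigraph"
  assumes fin: "finite (verts G)" and V: "verts H = verts G" and sub: "edges G \<subseteq> edges H"
    and z: "eigenfunction H m z" and pos: "\<And>v. v \<in> verts G \<Longrightarrow> z v > 0"
    and f: "eigenfunction G l f"
  shows "l \<le> m"
    and "l = m \<Longrightarrow> eigenfunction H m (\<lambda>v. \<bar>f v\<bar>)"
    and "l = m \<Longrightarrow> u \<in> verts G \<Longrightarrow>
      (\<Sum>v\<in>verts G. if {u, v} \<in> edges G then \<bar>f v\<bar> else 0) =
      (\<Sum>v\<in>verts G. if {u, v} \<in> edges H then \<bar>f v\<bar> else 0)"
proof -
  define g where "g u = (\<Sum>v\<in>verts G. if {u, v} \<in> edges G then \<bar>f v\<bar> else 0)" for u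
  define h where "h u = (\<Sum>v\<in>verts G. if {u, v} \<in> edges H then \<bar>f v\<bar> else 0)" for u
  have gh: "g u \<le> h u" for u
    unfolding g_def h_def using sub by (intro sum_mono) auto
  have lg: "\<bar>l\<bar> * \<bar>f u\<bar> \<le> g u" if "u \<in> verts G" for u
  proof -
    have "\<bar>l\<bar> * \<bar>f u\<bar> = \<bar>\<Sum>v\<in>verts G. if {u, v} \<in> edges G then f v else 0\<bar>"
      using f that by (simp add: eigenfunction_def abs_mult)
    also have "\<dots> \<le> (\<Sum>v\<in>verts G. \<bar>if {u, v} \<in> edges G then f v else 0\<bar>)" by (rule sum_abs)
    also have "\<dots> = g u" unfolding g_def by (intro sum.cong) auto
    finally show ?thesis .
  qed
  define s where "s = (\<Sum>v\<in>verts G. z v * \<bar>f v\<bar>)"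
  \<comment> \<open>Symmetry of adjacency moves the neighbour sum in \<open>H\<close> from the
    absolute value of \<open>f\<close> onto \<open>z\<close>, where the eigenvalue equation
    applies.\<close>
  have "(\<Sum>u\<in>verts G. z u * h u) =
      (\<Sum>u\<in>verts G. \<Sum>v\<in>verts G. if {v, u} \<in> edges H then z u * \<bar>f v\<bar> else 0)"
    unfolding h_def sum_distrib_left by (intro sum.cong) (auto simp: insert_commute)
  also have "\<dots> = (\<Sum>v\<in>verts G. \<Sum>u\<in>verts G. if {v, u} \<in> edges H then z u * \<bar>f v\<bar> else 0)"
    by (rule sum.swap)
  also have "\<dots> = (\<Sum>v\<in>verts G. (\<Sum>u\<in>verts G. if {v, u} \<in> edges H then z u else 0) * \<bar>f v\<bar>)"
    unfolding sum_distrib_right by (intro sum.cong) auto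
  also have "\<dots> = m * s"
    using z by (simp add: eigenfunction_def V s_def sum_distrib_left mult_ac)
  finally have zh: "(\<Sum>u\<in>verts G. z u * h u) = m * s" .
  have d0: "0 \<le> z u * (h u - \<bar>l\<bar> * \<bar>f u\<bar>)" if "u \<in> verts G" for u
    using gh[of u] lg[OF that] pos[OF that] by (intro mult_nonneg_nonneg) auto
  have dsum: "(\<Sum>u\<in>verts G. z u * (h u - \<bar>l\<bar> * \<bar>f u\<bar>)) = (m - \<bar>l\<bar>) * s"
    using zh by (simp add: right_diff_distrib sum_subtractf s_def sum_distrib_left mult_ac)
  obtain v where v: "v \<in> verts G" "f v \<noteq> 0" using f by (auto simp: eigenfunction_def)
  then have "0 < z v * \<bar>f v\<bar>" using pos by simp
  moreover have "0 \<le> z u * \<bar>f u\<bar>" if "u \<in> verts G" for u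
    using pos[OF that] by (simp add: less_imp_le)
  ultimately have s: "s > 0"
    unfolding s_def using v(1) by (intro sum_pos2[OF fin])
  have "0 \<le> (m - \<bar>l\<bar>) * s" unfolding dsum[symmetric] using d0 by (rule sum_nonneg)
  then have "\<bar>l\<bar> \<le> m" using s by (simp add: zero_le_mult_iff)
  then show "l \<le> m" by simp
  \<comment> \<open>For \<open>l = m\<close> the nonnegative terms in \<open>d0\<close> sum to zero,
    so each of them vanishes, and \<open>z u > 0\<close> can be cancelled.\<close>
  have hl: "h u = m * \<bar>f u\<bar>" if "l = m" "u \<in> verts G" for u
  proof -
    have "m \<ge> 0" using \<open>\<bar>l\<bar> \<le> m\<close> by simp
    then have "(\<Sum>u\<in>verts G. z u * (h u - m * \<bar>f u\<bar>)) = 0" using dsum that by simp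
    then have "z u * (h u - m * \<bar>f u\<bar>) = 0"
      using sum_nonneg_eq_0_iff[OF fin, of "\<lambda>u. z u * (h u - m * \<bar>f u\<bar>)"] d0 that \<open>m \<ge> 0\<close> by simp
    then show ?thesis using pos[OF that(2)] by simp
  qed
  show "eigenfunction H m (\<lambda>v. \<bar>f v\<bar>)" if "l = m"
    using hl[OF that] v by (auto simp: eigenfunction_def V h_def)
  show "g u = h u" if "l = m" "u \<in> verts G" for u
    using hl[OF that] lg[OF that(2)] gh[of u] that \<open>\<bar>l\<bar> \<le> m\<close> by simp
qed

section \<open>Edge-maximal non-traceable bipartite graphs\<close>

text \<open>The parts alternate along a path, so the surplus of \<open>Xpart\<close> vertices
  depends only on the two ends: it is 1, 0 or -1.\<close>

lemma alternating_count:
  assumes G: "bipartite_graph G"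
    and p: "successively (\<lambda>u v. {u, v} \<in> edges G) p" "p \<noteq> []" "set p \<subseteq> verts G"
  shows "int (length (filter (\<lambda>v. v \<in> Xpart G) p)) - int (length (filter (\<lambda>v. v \<in> Ypart G) p)) =
    of_bool (hd p \<in> Xpart G) + of_bool (last p \<in> Xpart G) - 1"
  using p
proof (induction p rule: induct_list012)
  case (2 v)
  then show ?case using G by (auto simp: bipartite_graph_def verts_def)
next
  case (3 u v p)
  have "Xpart G \<inter> Ypart G = {}" using G by (simp add: bipartite_graph_def)
  moreover have "u \<in> Xpart G \<and> v \<in> Ypart G \<or> u \<in> Ypart G \<and> v \<in> Xpart G"
    using 3 bipartite_edgeD[OF G, of u v] by simp
  ultimately show ?case using "3.IH"(2) "3.prems" by auto
qed simp

lemma Hamilton_path_ends: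
  assumes G: "bipartite_graph G" and cards: "card (Xpart G) = card (Ypart G) + 1"
    and p: "successively (\<lambda>u v. {u, v} \<in> edges G) p" "distinct p" "set p = verts G"
  shows "hd p \<in> Xpart G \<and> last p \<in> Xpart G"
proof -
  have "verts G \<noteq> {}" using cards by (auto simp: verts_def)
  then have "p \<noteq> []" using p(3) by auto
  have "length (filter (\<lambda>v. v \<in> Xpart G) p) = card (Xpart G)"
    "length (filter (\<lambda>v. v \<in> Ypart G) p) = card (Ypart G)"
    using p(2,3) by (simp_all add: distinct_length_filter verts_def Int_absorb2)
  then have "of_bool (hd p \<in> Xpart G) + of_bool (last p \<in> Xpart G) - 1 = (1 :: int)"
    using alternating_count[OF G p(1) \<open>p \<noteq> []\<close>] p(3) cards by simp
  then show ?thesis by (auto simp: of_bool_def split: if_splits)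
qed

lemma traceableI:
  assumes "successively (\<lambda>u v. {u, v} \<in> edges G) p" "distinct p" "set p = verts G" "p \<noteq> []"
  shows "traceable G"
  using assms by (auto simp: traceable_def)

lemma successively_edges_rev:
  "successively (\<lambda>u v. {u, v} \<in> E) (rev p) \<longleftrightarrow> successively (\<lambda>u v. {u, v} \<in> E) p"
  by (simp add: successively_rev insert_commute)

text \<open>A Hamilton path of the enlarged graph must traverse the new edge, since otherwise it
  would lie in \<open>H\<close>. Reversing the path if necessary puts \<open>x\<close> before
  \<open>y\<close>.\<close>

lemma Hamilton_path_split:
  assumes nt: "\<not> traceable H" and tr: "traceable (H\<lparr>edges := insert {x, y} (edges H)\<rparr>)"
  obtains as bs where "distinct (as @ x # y # bs)" "set (as @ x # y # bs) = verts H"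
    "successively (\<lambda>u v. {u, v} \<in> insert {x, y} (edges H)) (as @ x # y # bs)"
proof -
  let ?A = "\<lambda>u v. {u, v} \<in> insert {x, y} (edges H)"
  obtain p where p: "p \<noteq> []" "distinct p" "set p = verts H" "successively ?A p"
    using tr by (auto simp: traceable_def verts_def)
  have "\<not> successively (\<lambda>u v. {u, v} \<in> edges H) p"
    using nt p traceableI by blast
  then obtain i where i: "Suc i < length p" "{p ! i, p ! Suc i} \<notin> edges H"
    by (auto simp: successively_conv_nth)
  have "?A (p ! i) (p ! Suc i)" using p(4) i(1) by (simp add: successively_conv_nth)
  then have xy: "p ! i = x \<and> p ! Suc i = y \<or> p ! i = y \<and> p ! Suc i = x"
    using i(2) by (auto simp: doubleton_eq_iff)
  define as where "as = take i p"
  define bs where "bs = drop (Suc (Suc i)) p"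
  have pe: "p = as @ p ! i # p ! Suc i # bs"
    unfolding as_def bs_def using i(1) by (simp add: Cons_nth_drop_Suc)
  show thesis
  proof (cases "p ! i = x \<and> p ! Suc i = y")
    case True
    then show thesis using that[of as bs] pe p by simp
  next
    case False
    then have "p ! i = y" "p ! Suc i = x" using xy by auto
    then have pe: "p = as @ y # x # bs" using pe by simp
    then have "rev p = rev bs @ x # y # rev as" by simp
    moreover have "successively ?A (rev p)" using p(4) by (simp only: successively_edges_rev)
    ultimately show thesis
      using that[of "rev bs" "rev as"] p by (metis distinct_rev set_rev)
  qed
qed

text \<open>A path version of Ore's argument: cutting the Hamilton path at the new edge leaves two
  paths of \<open>H\<close>, and the degree bound follows because they cannot be reconnected inside
  \<open>H\<close>.\<close>

lemma Hamilton_closure_degree_sum: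
  fixes H :: "'a bigraph"
  assumes H: "bipartite_graph H" and cards: "card (Xpart H) = card (Ypart H) + 1"
    and nt: "\<not> traceable H"
    and x: "x \<in> Xpart H" and y: "y \<in> Ypart H" and xy: "{x, y} \<notin> edges H"
    and tr: "traceable (H\<lparr>edges := insert {x, y} (edges H)\<rparr>)"
  shows "vertex_degree H x + vertex_degree H y \<le> card (Ypart H)"
proof -
  let ?A = "\<lambda>u v. {u, v} \<in> edges H"
  define H' where "H' = H\<lparr>edges := insert {x, y} (edges H)\<rparr>"
  have H': "bipartite_graph H'"
    using H x y by (auto simp: H'_def bipartite_graph_def)
  have fin: "finite (Xpart H)" "finite (Ypart H)" and disj: "Xpart H \<inter> Ypart H = {}"
    using H by (auto simp: bipartite_graph_def)
  obtain as bs where p: "distinct (as @ x # y # bs)" "set (as @ x # y # bs) = verts H"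
    "successively (\<lambda>u v. {u, v} \<in> insert {x, y} (edges H)) (as @ x # y # bs)"
    using Hamilton_path_split[OF nt tr] .
  define p where "p = as @ x # y # bs"
  have ends: "hd p \<in> Xpart H" "last p \<in> Xpart H"
    using Hamilton_path_ends[OF H', of p] cards p by (simp_all add: H'_def verts_def p_def)
  \<comment> \<open>The first segment is reversed to start at \<open>x\<close>, the second to end at
    \<open>y\<close>.\<close>
  define q1 where "q1 = x # rev as"
  define q2 where "q2 = rev bs @ [y]"
  have q1': "rev q1 = as @ [x]" and q2': "rev q2 = y # bs" by (simp_all add: q1_def q2_def)
  have s: "successively (\<lambda>u v. {u, v} \<in> insert {x, y} (edges H)) ((as @ [x]) @ (y # bs))"
    using p(3) by simp
  have s1: "successively (\<lambda>u v. {u, v} \<in> insert {x, y} (edges H)) (as @ [x])"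
    and s2: "successively (\<lambda>u v. {u, v} \<in> insert {x, y} (edges H)) (y # bs)"
    using s unfolding successively_append_iff[of _ "as @ [x]"] by blast+
  have "successively ?A (as @ [x])"
    by (rule successively_mono[OF s1]) (use p(1) in \<open>auto simp: doubleton_eq_iff\<close>)
  moreover have "successively ?A (y # bs)"
    by (rule successively_mono[OF s2]) (use p(1) in \<open>auto simp: doubleton_eq_iff\<close>)
  ultimately have sq: "successively ?A q1" "successively ?A q2"
    "successively ?A (rev q1)" "successively ?A (rev q2)"
    by (simp_all only: q1'[symmetric] q2'[symmetric] successively_edges_rev)
  have dq: "distinct (q1 @ q2)" and setq: "set (q1 @ q2) = verts H"
    using p(1,2) by (auto simp: q1_def q2_def)
  have lq1: "last q1 = hd p" and lq2: "last q2 = y" and hq1: "hd q1 = x"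
    by (cases as; simp add: q1_def q2_def p_def)+
  have ne: "q1 \<noteq> []" "q2 \<noteq> []" by (simp_all add: q1_def q2_def)
  have no: False if "successively ?A r" "distinct r" "set r = set (q1 @ q2)" for r
  proof -
    have "r \<noteq> []" using that(3) ne by (metis append_is_Nil_conv set_empty)
    then show False using traceableI[OF that(1,2)] that(3) setq nt by simp
  qed
  \<comment> \<open>A neighbour \<open>a\<close> of \<open>y\<close> followed on \<open>q1\<close> or \<open>q2\<close> by a neighbour \<open>b\<close> of \<open>x\<close>
    allows rerouting into a Hamilton path of \<open>H\<close>; so successors inject \<open>N(y)\<close> into
    \<open>Y - N(x)\<close>.\<close>
  have f1: False if e: "q1 = c @ a # b # d" and ab: "?A a y" "?A x b" for c a b d
  proof -
    have "successively ?A (c @ [a])" "successively ?A (b # d)"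
      using sq(1) unfolding e by (auto simp: successively_append_iff successively_Cons)
    moreover have "hd (c @ [a]) = x" using hq1 e by (cases c) auto
    \<comment> \<open>From the end of \<open>d\<close> back to \<open>b\<close>, across to
      \<open>x\<close>, along \<open>q1\<close> to \<open>a\<close>, across to \<open>y\<close>,
      then backwards along \<open>q2\<close>.\<close>
    ultimately have "successively ?A (rev (b # d) @ (c @ [a]) @ rev q2)"
      using ab sq(4) lq2 ne(2) unfolding successively_append_iff successively_edges_rev
      by (simp add: last_rev hd_rev hd_append insert_commute split: if_splits)
    from no[OF this] show False using dq by (auto simp: e)
  qed
  have f2: False if e: "q2 = c @ a # b # d" and ab: "?A a y" "?A x b" for c a b d
  proof -
    have "successively ?A (c @ [a])" "successively ?A (b # d)"
      using sq(2) unfolding e by (auto simp: successively_append_iff successively_Cons)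
    moreover have "last (b # d) = y" using lq2 e by (cases d) auto
    \<comment> \<open>Along \<open>q2\<close> to \<open>a\<close>, across to \<open>y\<close>, back
      to \<open>b\<close>, across to \<open>x\<close>, then along \<open>q1\<close>.\<close>
    ultimately have "successively ?A ((c @ [a]) @ rev (b # d) @ q1)"
      using ab sq(1) hq1 ne(1) unfolding successively_append_iff successively_edges_rev
      by (simp add: last_rev hd_rev hd_append insert_commute split: if_splits)
    from no[OF this] show False using dq by (auto simp: e)
  qed
  \<comment> \<open>The last vertex of \<open>q1\<close> has no successor within \<open>q1\<close>.
    If it were adjacent to \<open>y\<close>, then \<open>q1\<close> followed by the reversed
    \<open>q2\<close> would be a Hamilton path.\<close>
  have f3: "\<not> ?A (last q1) y"
  proof
    assume "?A (last q1) y"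
    then have "successively ?A (q1 @ rev q2)"
      using sq(1,4) lq2 ne by (auto simp: successively_append_iff hd_rev)
    then show False by (rule no) (use dq in auto)
  qed
  define q where "q = q1 @ q2"
  define N where "N = length q"
  have succ: "Suc i < N \<and> q ! Suc i \<in> Ypart H \<and> \<not> ?A x (q ! Suc i)"
    if i: "i < N" "?A (q ! i) y" for i
  proof (cases "i < length q1")
    case True
    then have qi: "q ! i = q1 ! i" by (simp add: q_def nth_append)
    have "Suc i \<noteq> length q1"
    proof
      assume "Suc i = length q1"
      then have "q1 ! i = last q1" using ne by (simp add: last_conv_nth flip: \<open>Suc i = length q1\<close>)
      then show False using f3 i(2) qi by simp
    qed
    then have S: "Suc i < length q1" using True by simp
    then have qS: "q ! Suc i = q1 ! Suc i" by (simp add: q_def nth_append)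
    have "q1 = take i q1 @ q1 ! i # q1 ! Suc i # drop (Suc (Suc i)) q1"
      using S by (simp add: Cons_nth_drop_Suc)
    from f1[OF this] have "\<not> ?A x (q ! Suc i)" using i(2) qi qS by auto
    moreover have "?A (q ! i) (q ! Suc i)"
      using sq(1) S unfolding qi qS by (simp add: successively_conv_nth)
    then have "q ! Suc i \<in> Ypart H"
      using bipartite_edgeD[OF H] i(2) y disj by blast
    ultimately show ?thesis using S by (simp add: N_def q_def)
  next
    case False
    define j where "j = i - length q1"
    have qi: "q ! i = q2 ! j" "j < length q2"
      using False i(1) by (auto simp: q_def N_def j_def nth_append)
    \<comment> \<open>The path \<open>q2\<close> ends at \<open>y\<close>, which is not its own
      neighbour, so a neighbour of \<open>y\<close> on \<open>q2\<close> has a successor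
      there.\<close>
    have "Suc j \<noteq> length q2"
    proof
      assume "Suc j = length q2"
      then have "q2 ! j = last q2" using ne by (simp add: last_conv_nth flip: \<open>Suc j = length q2\<close>)
      then have "?A y y" using i(2) qi lq2 by simp
      then show False using bipartite_edgeD[OF H] y disj by blast
    qed
    then have S: "Suc j < length q2" using qi by simp
    then have qS: "q ! Suc i = q2 ! Suc j" using False by (simp add: q_def nth_append j_def Suc_diff_le)
    have "q2 = take j q2 @ q2 ! j # q2 ! Suc j # drop (Suc (Suc j)) q2"
      using S by (simp add: Cons_nth_drop_Suc)
    from f2[OF this] have "\<not> ?A x (q ! Suc i)" using i(2) qi qS by auto
    moreover have "?A (q ! i) (q ! Suc i)"
      using sq(2) S unfolding qi qS by (simp add: successively_conv_nth)
    then have "q ! Suc i \<in> Ypart H"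
      using bipartite_edgeD[OF H] i(2) y disj by blast
    moreover have "Suc i < N" using S False by (simp add: N_def q_def j_def)
    ultimately show ?thesis by simp
  qed
  have inj: "inj_on ((!) q) {..<N}"
    using dq by (simp add: N_def q_def inj_on_nth)
  have setN: "(!) q ` {..<N} = verts H"
    using setq by (auto simp: N_def q_def[symmetric] set_conv_nth)
  define S where "S = {i. i < N \<and> ?A (q ! i) y}"
  have "card S = vertex_degree H y"
  proof -
    have "(!) q ` S = {u \<in> verts H. ?A u y}" unfolding S_def setN[symmetric] by auto
    moreover have "inj_on ((!) q) S" by (rule inj_on_subset[OF inj]) (auto simp: S_def)
    ultimately show ?thesis using card_image[of "(!) q" S] by (simp add: vertex_degree_def)
  qed
  moreover have "inj_on (\<lambda>i. q ! Suc i) S"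
    using succ inj by (auto simp: S_def inj_on_def)
  moreover have "(\<lambda>i. q ! Suc i) ` S \<subseteq> Ypart H - {v \<in> verts H. ?A v x}"
    using succ by (auto simp: S_def insert_commute)
  ultimately have "vertex_degree H y \<le> card (Ypart H - {v \<in> verts H. ?A v x})"
    using card_inj_on_le[of "\<lambda>i. q ! Suc i" S] fin by simp
  moreover have "{v \<in> verts H. ?A v x} \<subseteq> Ypart H"
    using bipartite_edgeD[OF H, of _ x] x disj by auto
  then have "card (Ypart H - {v \<in> verts H. ?A v x}) + vertex_degree H x = card (Ypart H)"
    unfolding vertex_degree_def using fin card_mono[of "Ypart H" "{v \<in> verts H. ?A v x}"]
    by (subst card_Diff_subset) (auto intro: finite_subset)
  ultimately show ?thesis by simp
qed

section \<open>Existence of the edge-maximal graph\<close>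

text \<open>Induction removes one vertex from each part; that the path starts in \<open>X\<close> is
  what allows \<open>x # y\<close> to be prepended.\<close>

lemma complete_bipartite_path:
  assumes "finite X" "finite Y" "X \<inter> Y = {}" "card X = card Y + 1"
  shows "\<exists>p. distinct p \<and> set p = X \<union> Y \<and> p \<noteq> [] \<and> hd p \<in> X \<and>
    successively (\<lambda>u v. u \<in> X \<and> v \<in> Y \<or> u \<in> Y \<and> v \<in> X) p"
  using assms
proof (induction "card Y" arbitrary: X Y)
  case 0
  then obtain x where "X = {x}" by (metis One_nat_def add_0 card_1_singletonE)
  with 0 show ?case by (intro exI[of _ "[x]"]) auto
next
  case (Suc n)
  obtain y where y: "y \<in> Y" using Suc by fastforce
  obtain x where x: "x \<in> X" using Suc by fastforce
  have "n = card (Y - {y})" "card (X - {x}) = card (Y - {y}) + 1"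
    using Suc.hyps(2) Suc.prems x y by auto
  moreover have "finite (X - {x})" "finite (Y - {y})" "(X - {x}) \<inter> (Y - {y}) = {}"
    using Suc.prems by auto
  ultimately obtain p where
    p: "distinct p" "set p = X - {x} \<union> (Y - {y})" "p \<noteq> []" "hd p \<in> X - {x}"
      "successively (\<lambda>u v. u \<in> X - {x} \<and> v \<in> Y - {y} \<or> u \<in> Y - {y} \<and> v \<in> X - {x}) p"
    using Suc.hyps(1)[of "Y - {y}" "X - {x}"] by blast
  have "successively (\<lambda>u v. u \<in> X \<and> v \<in> Y \<or> u \<in> Y \<and> v \<in> X) p"
    by (rule successively_mono[OF p(5)]) auto
  then have "successively (\<lambda>u v. u \<in> X \<and> v \<in> Y \<or> u \<in> Y \<and> v \<in> X) (x # y # p)"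
    using x y p(3,4) by (cases p) auto
  moreover have "distinct (x # y # p)" "set (x # y # p) = X \<union> Y"
    using x y p(1,2) Suc.prems by auto
  ultimately show ?case using x by (intro exI[of _ "x # y # p"]) auto
qed

text \<open>Choose a maximal non-traceable edge set above \<open>edges G\<close>. Adding any missing
  edge between the parts creates a Hamilton path, so the degree-sum bound applies to every such
  pair.\<close>

lemma nontraceable_closure:
  fixes G :: "'a bigraph"
  assumes G: "bipartite_graph G" and cards: "card (Xpart G) = card (Ypart G) + 1"
    and nt: "\<not> traceable G"
  obtains H where "bipartite_graph H" "Xpart H = Xpart G" "Ypart H = Ypart G" "edges G \<subseteq> edges H"
    and "\<exists>x\<in>Xpart G. \<exists>y\<in>Ypart G. {x, y} \<notin> edges H"
    and "\<And>x y. x \<in> Xpart G \<Longrightarrow> y \<in> Ypart G \<Longrightarrow> {x, y} \<notin> edges H \<Longrightarrow>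
      vertex_degree H x + vertex_degree H y \<le> card (Ypart G)"
proof -
  define K where "K = {{x, y} | x y. x \<in> Xpart G \<and> y \<in> Ypart G}"
  have fin: "finite (Xpart G)" "finite (Ypart G)" and disj: "Xpart G \<inter> Ypart G = {}"
    and GK: "edges G \<subseteq> K"
    using G by (auto simp: bipartite_graph_def K_def)
  have "K \<subseteq> Pow (verts G)" by (auto simp: K_def verts_def)
  then have finK: "finite K" using fin by (auto simp: verts_def intro: finite_subset)
  define \<F> where "\<F> = {F. F \<subseteq> K \<and> \<not> traceable (G\<lparr>edges := F\<rparr>)}"
  have finF: "finite \<F>" using finK by (auto simp: \<F>_def)
  have "edges G \<in> \<F>" using nt GK by (simp add: \<F>_def)
  from finite_has_maximal2[OF finF this] obtain F where F: "F \<in> \<F>" "edges G \<subseteq> F" "\<And>F'. F' \<in> \<F> \<Longrightarrow> F \<subseteq> F' \<Longrightarrow> F = F'"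
    by auto
  define H where "H = G\<lparr>edges := F\<rparr>"
  have H: "bipartite_graph H" using G F(1) by (auto simp: H_def bipartite_graph_def \<F>_def K_def)
  have ntH: "\<not> traceable H" using F(1) by (simp add: H_def \<F>_def)
  \<comment> \<open>The maximal graph cannot be complete bipartite, because with these part sizes
    that graph has a Hamilton path.\<close>
  have "\<exists>x\<in>Xpart G. \<exists>y\<in>Ypart G. {x, y} \<notin> edges H"
  proof (rule ccontr)
    assume "\<not> ?thesis"
    then have all: "\<And>x y. x \<in> Xpart G \<Longrightarrow> y \<in> Ypart G \<Longrightarrow> {x, y} \<in> edges H" by auto
    obtain p where p: "distinct p" "set p = Xpart G \<union> Ypart G" "p \<noteq> []"
      "successively (\<lambda>u v. u \<in> Xpart G \<and> v \<in> Ypart G \<or> u \<in> Ypart G \<and> v \<in> Xpart G) p"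
      using complete_bipartite_path[OF fin disj cards] by blast
    have "successively (\<lambda>u v. {u, v} \<in> edges H) p"
      by (rule successively_mono[OF p(4)]) (use all in \<open>metis insert_commute\<close>)
    then have "traceable H" using p by (intro traceableI) (auto simp: H_def verts_def)
    with ntH show False by simp
  qed
  moreover have "vertex_degree H x + vertex_degree H y \<le> card (Ypart G)"
    if xy: "x \<in> Xpart G" "y \<in> Ypart G" "{x, y} \<notin> edges H" for x y
  proof -
    have "insert {x, y} F \<notin> \<F>" using F(3)[of "insert {x, y} F"] xy by (auto simp: H_def)
    then have "traceable (H\<lparr>edges := insert {x, y} (edges H)\<rparr>)"
      using F(1) xy by (auto simp: \<F>_def K_def H_def)
    then show ?thesis
      using Hamilton_closure_degree_sum[OF H _ ntH] xy cards by (simp add: H_def)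
  qed
  ultimately show thesis using that[OF H] F(2) by (simp add: H_def)
qed

section \<open>Spectra of the extremal graphs\<close>

text \<open>Both \<open>S\<close> (with \<open>|A| = k\<close>, \<open>|B| = n - k - 1\<close>) and \<open>T\<close> for
  \<open>k = 0\<close> (with \<open>A = {}\<close>) have this form; the remaining vertices of the two parts
  induce an edgeless graph.\<close>

definition half_join :: "'a bigraph \<Rightarrow> 'a set \<Rightarrow> 'a set \<Rightarrow> bool" where
  "half_join G A B \<longleftrightarrow> bipartite_graph G \<and> A \<subseteq> Xpart G \<and> B \<subseteq> Ypart G \<and>
     (\<forall>x\<in>Xpart G. \<forall>y\<in>Ypart G. {x, y} \<in> edges G \<longleftrightarrow> x \<in> A \<or> y \<in> B)"

lemma sum_split_subset:
  fixes c d :: real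
  assumes "finite S" "B \<subseteq> S"
  shows "(\<Sum>y\<in>S. if y \<in> B then c else d) = real (card B) * c + real (card S - card B) * d"
proof -
  have "(\<Sum>y\<in>S. if y \<in> B then c else d) = card (S \<inter> B) * c + card (S \<inter> - B) * d"
    using assms(1) by (simp add: sum.If_cases)
  moreover have "S \<inter> B = B" "S \<inter> - B = S - B" using assms(2) by auto
  ultimately show ?thesis
    using assms by (simp add: card_Diff_subset finite_subset)
qed

text \<open>A monic quadratic is negative only strictly between its roots, so a negative value at
  \<open>t\<close> certifies that \<open>t\<close> lies below the larger one.\<close>

lemma larger_root_bounds:
  fixes e d :: real
  assumes "e\<^sup>2 \<ge> 4 * d"
  obtains m where "m\<^sup>2 - e * m + d = 0" "\<And>t. t\<^sup>2 - e * t + d < 0 \<Longrightarrow> t < m"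
proof
  define s where "s = sqrt (e\<^sup>2 - 4 * d)"
  have s: "s \<ge> 0" "s\<^sup>2 = e\<^sup>2 - 4 * d" using assms by (simp_all add: s_def)
  show "((e + s) / 2)\<^sup>2 - e * ((e + s) / 2) + d = 0"
    using s(2) by (simp add: power2_eq_square field_simps)
  show "t < (e + s) / 2" if "t\<^sup>2 - e * t + d < 0" for t
  proof (rule ccontr)
    assume "\<not> t < (e + s) / 2"
    then have "s \<le> 2 * t - e" by simp
    then have "s\<^sup>2 \<le> (2 * t - e)\<^sup>2" using s(1) by (rule power_mono)
    then show False using that s(2) by (simp add: power2_eq_square algebra_simps)
  qed
qed

text \<open>Here \<open>r\<^sup>2\<close> is the larger root of
  \<open>\<mu>\<^sup>2 - (m k + q k + p m) \<mu> + m k p q\<close>, obtained from the quotient matrix of the partition of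
  the vertices into \<open>A\<close>, \<open>X - A\<close>, \<open>B\<close>, \<open>Y - B\<close>. The eigenvalue property is
  stated for two vertex types because an obtained number \<open>r\<close> is usable only at fixed types.\<close>

lemma half_join_eigenvalue:
  fixes k m p q :: nat
  assumes "k > 0" "m > 0" "p > 0" "q > 0"
  obtains r :: real where "r > 0" "real ((k + p) * m) < r\<^sup>2" "r\<^sup>2 < real (m * k + q * k + p * m)"
    and "\<And>(G :: 'a bigraph) A B. half_join G A B \<Longrightarrow> card A = k \<Longrightarrow> card (Xpart G) = k + p \<Longrightarrow>
      card B = m \<Longrightarrow> card (Ypart G) = m + q \<Longrightarrow>
      \<exists>z. eigenfunction G r z \<and> (\<forall>v\<in>verts G. z v > 0)"
    and "\<And>(G :: 'b bigraph) A B. half_join G A B \<Longrightarrow> card A = k \<Longrightarrow> card (Xpart G) = k + p \<Longrightarrow>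
      card B = m \<Longrightarrow> card (Ypart G) = m + q \<Longrightarrow> \<exists>z. eigenfunction G r z"
proof -
  define K M P Q where "K = real k" "M = real m" "P = real p" "Q = real q"
  have pos: "K > 0" "M > 0" "P > 0" "Q > 0" using assms by (simp_all add: K_M_P_Q_def)
  define e where "e = M * K + Q * K + P * M"
  define d where "d = M * K * P * Q"
  have d: "d > 0" using pos by (simp add: d_def)
  have "4 * d \<le> (Q * K + P * M)\<^sup>2"
    using zero_le_power2[of "Q * K - P * M"] by (simp add: d_def power2_eq_square algebra_simps)
  also have "\<dots> \<le> e\<^sup>2" using pos by (intro power_mono) (auto simp: e_def)
  finally obtain \<mu> where \<mu>: "\<mu>\<^sup>2 - e * \<mu> + d = 0" "\<And>t. t\<^sup>2 - e * t + d < 0 \<Longrightarrow> t < \<mu>"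
    using larger_root_bounds[of d e] by auto
  \<comment> \<open>The quadratic takes the same negative value at \<open>(K + P) * M\<close> and at
    \<open>K * Q\<close>, so both lie below \<mu>. The first bound is the one to be proved, the
    second makes \<open>a2\<close> positive.\<close>
  have "((K + P) * M)\<^sup>2 - e * ((K + P) * M) + d = - (K * K * M * Q)"
    by (simp add: e_def d_def power2_eq_square algebra_simps)
  then have lb: "(K + P) * M < \<mu>" using \<mu>(2) pos by simp
  have "(K * Q)\<^sup>2 - e * (K * Q) + d = - (K * K * M * Q)"
    by (simp add: e_def d_def power2_eq_square algebra_simps)
  then have lb': "K * Q < \<mu>" using \<mu>(2) pos by simp
  then have \<mu>0: "\<mu> > 0" using pos by (smt (verit) mult_pos_pos)
  \<comment> \<open>The roots have sum \<open>e\<close> and product \<open>d > 0\<close>, so \<mu>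
    lies below \<open>e\<close>.\<close>
  have "\<mu> * (e - \<mu>) = d" using \<mu>(1) by (simp add: power2_eq_square algebra_simps)
  then have "\<mu> * (e - \<mu>) > 0" using d by simp
  then have ub: "\<mu> < e" using \<mu>0 by (simp add: zero_less_mult_iff)
  define r where "r = sqrt \<mu>"
  have r: "r > 0" "r * r = \<mu>" "r\<^sup>2 = \<mu>" using \<mu>0 by (simp_all add: r_def)
  have ev: "\<exists>z. eigenfunction G r z \<and> (\<forall>v\<in>verts G. z v > 0)"
    if G: "half_join G A B" and c: "card A = k" "card (Xpart G) = k + p"
      "card B = m" "card (Ypart G) = m + q" for G :: "'c bigraph" and A B
  proof -
    have bip: "bipartite_graph G" and fin: "finite (Xpart G)" "finite (Ypart G)"
      and disj: "Xpart G \<inter> Ypart G = {}" and sub: "A \<subseteq> Xpart G" "B \<subseteq> Ypart G"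
      and E: "\<And>x y. x \<in> Xpart G \<Longrightarrow> y \<in> Ypart G \<Longrightarrow> {x, y} \<in> edges G \<longleftrightarrow> x \<in> A \<or> y \<in> B"
      using G by (auto simp: half_join_def bipartite_graph_def)
    \<comment> \<open>Values on \<open>A\<close>, \<open>Xpart G - A\<close>, \<open>B\<close> and
      \<open>Ypart G - B\<close>. The last two are solved from the equations at
      \<open>Ypart G\<close>; the equations at \<open>Xpart G\<close> then reduce to the quadratic
      for \<mu>.\<close>
    define a1 a2 b1 b2 where ab: "a1 = \<mu>" "a2 = \<mu> - K * Q" "b1 = (K * a1 + P * a2) / r" "b2 = K * a1 / r"
    have abpos: "a1 > 0" "a2 > 0" "b1 > 0" "b2 > 0"
      using \<mu>0 lb' pos r by (auto simp: ab intro!: divide_pos_pos add_pos_pos)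
    define z where "z v = (if v \<in> Xpart G then if v \<in> A then a1 else a2 else if v \<in> B then b1 else b2)" for v
    have rows: "M * b1 + Q * b2 = r * a1" "M * b1 = r * a2" "K * a1 + P * a2 = r * b1" "K * a1 = r * b2"
    proof -
      have "\<mu> * \<mu> = e * \<mu> - d" using \<mu>(1) by (simp add: power2_eq_square)
      then have "M * (K * a1 + P * a2) + Q * (K * a1) = r * r * a1" "M * (K * a1 + P * a2) = r * r * a2"
        by (simp_all add: ab r(2) e_def d_def algebra_simps)
      then show "M * b1 + Q * b2 = r * a1" "M * b1 = r * a2"
        using r(1) by (simp_all add: ab(3,4) field_simps)
    qed (use r(1) in \<open>simp_all add: ab\<close>)
    have cd: "real (card A) = K" "real (card (Xpart G) - card A) = P"
      "real (card B) = M" "real (card (Ypart G) - card B) = Q"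
      using c by (simp_all add: K_M_P_Q_def)
    have nz: "\<exists>v\<in>verts G. z v \<noteq> 0"
    proof -
      obtain v where "v \<in> A" using c(1) assms(1) by (metis card.empty ex_in_conv less_irrefl)
      then show ?thesis using sub abpos by (intro bexI[of _ v]) (auto simp: z_def verts_def)
    qed
    have "eigenfunction G r z"
    proof (rule eigenfunction_bipartiteI[OF bip nz])
      fix x assume x: "x \<in> Xpart G"
      have "(\<Sum>y\<in>Ypart G. if {x, y} \<in> edges G then z y else 0) =
          (\<Sum>y\<in>Ypart G. if y \<in> B then b1 else if x \<in> A then b2 else 0)"
        using E x disj by (intro sum.cong) (auto simp: z_def)
      also have "\<dots> = M * b1 + Q * (if x \<in> A then b2 else 0)"
        using sum_split_subset[OF fin(2) sub(2)] cd by simp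
      also have "\<dots> = r * z x" using rows x by (simp add: z_def)
      finally show "(\<Sum>y\<in>Ypart G. if {x, y} \<in> edges G then z y else 0) = r * z x" .
    next
      fix y assume y: "y \<in> Ypart G"
      have "(\<Sum>x\<in>Xpart G. if {x, y} \<in> edges G then z x else 0) =
          (\<Sum>x\<in>Xpart G. if x \<in> A then a1 else if y \<in> B then a2 else 0)"
        using E y disj by (intro sum.cong) (auto simp: z_def)
      also have "\<dots> = K * a1 + P * (if y \<in> B then a2 else 0)"
        using sum_split_subset[OF fin(1) sub(1)] cd by simp
      also have "\<dots> = r * z y" using rows y disj by (auto simp: z_def)
      finally show "(\<Sum>x\<in>Xpart G. if {x, y} \<in> edges G then z x else 0) = r * z y" .
    qed
    moreover have "\<forall>v\<in>verts G. z v > 0" using abpos by (simp add: z_def)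
    ultimately show ?thesis by blast
  qed
  show thesis
  proof (rule that[of r])
    show "real ((k + p) * m) < r\<^sup>2" "r\<^sup>2 < real (m * k + q * k + p * m)" "r > 0"
      using lb ub r by (simp_all add: K_M_P_Q_def e_def)
  qed (use ev in blast)+
qed

text \<open>At a zero of a nonnegative eigenfunction all neighbours are zeros too. With
  \<open>A\<close> and \<open>B\<close> nonempty the graph is connected, so a single zero would
  spread to every vertex.\<close>

lemma half_join_eigenfunction_pos:
  assumes G: "half_join G A B" and ne: "A \<noteq> {}" "B \<noteq> {}"
    and f: "eigenfunction G r f" and nonneg: "\<And>v. f v \<ge> 0" and v: "v \<in> verts G"
  shows "f v > 0"
proof (rule ccontr)
  have bip: "bipartite_graph G" and fin: "finite (Xpart G)" "finite (Ypart G)"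
    and disj: "Xpart G \<inter> Ypart G = {}" and sub: "A \<subseteq> Xpart G" "B \<subseteq> Ypart G"
    and E: "\<And>x y. x \<in> Xpart G \<Longrightarrow> y \<in> Ypart G \<Longrightarrow> {x, y} \<in> edges G \<longleftrightarrow> x \<in> A \<or> y \<in> B"
    using G by (auto simp: half_join_def bipartite_graph_def)
  assume "\<not> f v > 0"
  then have v0: "f v = 0" using nonneg[of v] by simp
  have X0: "f y = 0" if "x \<in> Xpart G" "f x = 0" "y \<in> Ypart G" "{x, y} \<in> edges G" for x y
  proof -
    have "(\<Sum>y\<in>Ypart G. if {x, y} \<in> edges G then f y else 0) = 0"
      using eigenfunction_bipartite(1)[OF bip f that(1)] that(2) by simp
    then have "(if {x, y} \<in> edges G then f y else 0) = 0"
      using nonneg fin that(3) by (subst (asm) sum_nonneg_eq_0_iff) auto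
    then show ?thesis using that(4) by simp
  qed
  have Y0: "f x = 0" if "y \<in> Ypart G" "f y = 0" "x \<in> Xpart G" "{x, y} \<in> edges G" for x y
  proof -
    have "(\<Sum>x\<in>Xpart G. if {x, y} \<in> edges G then f x else 0) = 0"
      using eigenfunction_bipartite(2)[OF bip f that(1)] that(2) by simp
    then have "(if {x, y} \<in> edges G then f x else 0) = 0"
      using nonneg fin that(3) by (subst (asm) sum_nonneg_eq_0_iff) auto
    then show ?thesis using that(4) by simp
  qed
  obtain a b where ab: "a \<in> A" "b \<in> B" using ne by auto
  have aXb: "a \<in> Xpart G" "b \<in> Ypart G" using ab sub by auto
  \<comment> \<open>The zero reaches \<open>b\<close> directly from \<open>Xpart G\<close>, or
    through \<open>a\<close> from \<open>Ypart G\<close>. From \<open>b\<close> it spreads over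
    \<open>Xpart G\<close>, and from \<open>a\<close> over \<open>Ypart G\<close>.\<close>
  have "f b = 0"
  proof (cases "v \<in> Xpart G")
    case True
    then show ?thesis using X0[OF True v0 aXb(2)] E[OF True aXb(2)] ab by simp
  next
    case False
    then have y: "v \<in> Ypart G" using v by (simp add: verts_def)
    have "f a = 0" using Y0[OF y v0 aXb(1)] E[OF aXb(1) y] ab by simp
    then show ?thesis using X0[OF aXb(1) _ aXb(2)] E[OF aXb] ab by simp
  qed
  then have allX: "f x = 0" if "x \<in> Xpart G" for x
    using Y0[OF aXb(2) _ that] E[OF that aXb(2)] ab by simp
  then have "f y = 0" if "y \<in> Ypart G" for y
    using X0[OF aXb(1) _ that] E[OF aXb(1) that] aXb ab by simp
  with allX f show False by (auto simp: eigenfunction_def verts_def)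
qed

text \<open>For \<open>l = r\<close> the absolute value of \<open>f\<close> is an eigenfunction of
  \<open>H\<close>, hence positive everywhere. A missing edge would make some neighbour sum in
  \<open>G\<close> strictly smaller than in \<open>H\<close>, against the equality case of the
  comparison.\<close>

lemma half_join_eigenvalue_maximal:
  fixes G H :: "'a bigraph"
  assumes G: "bipartite_graph G" and H: "half_join H A B" and ne: "A \<noteq> {}" "B \<noteq> {}"
    and parts: "Xpart H = Xpart G" "Ypart H = Ypart G" and sub: "edges G \<subseteq> edges H"
    and z: "eigenfunction H r z" "\<forall>v\<in>verts H. z v > 0"
    and f: "eigenfunction G l f"
  shows "l \<le> r" and "l = r \<Longrightarrow> edges G = edges H"
proof -
  have V: "verts H = verts G" using parts by (simp add: verts_def)
  have fin: "finite (verts G)" using G by (simp add: bipartite_graph_def verts_def)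
  have bH: "bipartite_graph H" using H by (simp add: half_join_def)
  note cmp = eigenfunction_compare[OF fin V sub z(1) _ f]
  show "l \<le> r" using cmp(1) z(2) V by simp
  show "edges G = edges H" if "l = r"
  proof -
    have ev: "eigenfunction H r (\<lambda>v. \<bar>f v\<bar>)" using cmp(2) z(2) V that by simp
    have pos: "\<bar>f v\<bar> > 0" if "v \<in> verts G" for v
      using half_join_eigenfunction_pos[OF H ne ev] that V by simp
    show ?thesis
    proof (rule bipartite_edges_eqI[OF G bH parts])
      fix x y assume xy: "x \<in> Xpart G" "y \<in> Ypart G"
      then have xV: "x \<in> verts G" "y \<in> verts G" by (auto simp: verts_def)
      show "{x, y} \<in> edges G \<longleftrightarrow> {x, y} \<in> edges H"
      proof
        assume h: "{x, y} \<in> edges H"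
        have "(\<Sum>v\<in>verts G. if {x, v} \<in> edges G then \<bar>f v\<bar> else 0) =
            (\<Sum>v\<in>verts G. if {x, v} \<in> edges H then \<bar>f v\<bar> else 0)"
          using cmp(3)[OF _ \<open>l = r\<close> xV(1)] z(2) V by simp
        then have "(if {x, y} \<in> edges G then \<bar>f y\<bar> else 0) = (if {x, y} \<in> edges H then \<bar>f y\<bar> else 0)"
          by (rule sum_mono_inv) (use sub fin xV in auto)
        then show "{x, y} \<in> edges G" using h pos[OF xV(2)] by (auto split: if_splits)
      qed (use sub in auto)
    qed
  qed
qed

section \<open>Isomorphism of half joins\<close>

lemma half_join_adjacent_iff:
  assumes "half_join G A B"
  shows "{u, v} \<in> edges G \<longleftrightarrow> u \<in> Xpart G \<and> v \<in> Ypart G \<and> (u \<in> A \<or> v \<in> B) \<or>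
    v \<in> Xpart G \<and> u \<in> Ypart G \<and> (v \<in> A \<or> u \<in> B)"
  using assms bipartite_edgeD[of G u v] insert_commute[of u v "{}"]
  unfolding half_join_def by metis

lemma bij_betw_pair:
  assumes "finite S" "A \<subseteq> S" "finite T" "B \<subseteq> T" "card S = card T" "card A = card B"
  obtains f where "bij_betw f S T" "f ` A = B"
proof -
  have fin: "finite A" "finite B" using assms finite_subset by auto
  then obtain f where f: "bij_betw f A B" using assms by (metis finite_same_card_bij)
  have "card (S - A) = card (T - B)" using assms fin by (simp add: card_Diff_subset)
  then obtain g where g: "bij_betw g (S - A) (T - B)"
    using assms by (metis finite_same_card_bij finite_Diff)
  have "bij_betw (\<lambda>x. if x \<in> A then f x else g x) (A \<union> (S - A)) (B \<union> (T - B))"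
    using f g by (rule bij_betw_disjoint_Un) auto
  moreover have "A \<union> (S - A) = S" "B \<union> (T - B) = T" using assms by auto
  moreover have "(\<lambda>x. if x \<in> A then f x else g x) ` A = B"
    using f by (auto simp: bij_betw_def)
  ultimately show thesis using that by auto
qed

text \<open>Adjacency depends only on membership in the parts, \<open>A\<close> and
  \<open>B\<close>, so bijections of the parts that carry \<open>A\<close> to \<open>A'\<close> and
  \<open>B\<close> to \<open>B'\<close> combine to an isomorphism.\<close>

lemma half_join_iso:
  assumes G: "half_join G A B" and H: "half_join H A' B'"
    and cards: "card (Xpart G) = card (Xpart H)" "card (Ypart G) = card (Ypart H)"
      "card A = card A'" "card B = card B'"
  shows "G \<cong>\<^sub>b H"
proof -
  have fin: "finite (Xpart G)" "finite (Ypart G)" "finite (Xpart H)" "finite (Ypart H)"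
    and disj: "Xpart G \<inter> Ypart G = {}" "Xpart H \<inter> Ypart H = {}"
    and sub: "A \<subseteq> Xpart G" "B \<subseteq> Ypart G" "A' \<subseteq> Xpart H" "B' \<subseteq> Ypart H"
    using G H by (auto simp: half_join_def bipartite_graph_def)
  obtain f where f: "bij_betw f (Xpart G) (Xpart H)" "f ` A = A'"
    using bij_betw_pair[of "Xpart G" A "Xpart H" A'] fin sub cards by blast
  obtain g where g: "bij_betw g (Ypart G) (Ypart H)" "g ` B = B'"
    using bij_betw_pair[of "Ypart G" B "Ypart H" B'] fin sub cards by blast
  define h where "h v = (if v \<in> Xpart G then f v else g v)" for v
  have h: "bij_betw h (verts G) (verts H)"
    unfolding h_def verts_def using f(1) g(1) disj by (rule bij_betw_disjoint_Un)
  have hX: "h v \<in> Xpart H \<longleftrightarrow> v \<in> Xpart G" and hY: "h v \<in> Ypart H \<longleftrightarrow> v \<in> Ypart G"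
    if "v \<in> verts G" for v
    using that f(1) g(1) disj by (auto simp: h_def verts_def bij_betw_def)
  have hA: "h v \<in> A' \<longleftrightarrow> v \<in> A" if "v \<in> Xpart G" for v
    using that f sub unfolding h_def bij_betw_def by (auto dest: inj_onD)
  have hB: "h v \<in> B' \<longleftrightarrow> v \<in> B" if "v \<in> Ypart G" for v
    using that g sub disj unfolding h_def bij_betw_def by (auto dest: inj_onD)
  have "h ` Xpart G = Xpart H" using f by (auto simp: h_def bij_betw_def)
  moreover have "h ` Ypart G = g ` Ypart G" using disj by (intro image_cong) (auto simp: h_def)
  then have "h ` Ypart G = Ypart H" using g by (simp add: bij_betw_def)
  moreover have "{u, v} \<in> edges G \<longleftrightarrow> {h u, h v} \<in> edges H" if "u \<in> verts G" "v \<in> verts G" for u v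
    unfolding half_join_adjacent_iff[OF G] half_join_adjacent_iff[OF H]
    using hX hY hA hB that by metis
  ultimately show ?thesis using h by (auto simp: bigraph_iso_def)
qed

section \<open>The graphs \<open>S_graph\<close> and \<open>T_graph\<close> as half joins\<close>

text \<open>The families are the complete block and the two kinds of join edges. Writing the
  \<open>Xpart\<close> end first in each of them matches \<open>half_join\<close>.\<close>

lemma edges_S_graph:
  "edges (S_graph n k) = {{Inl (Inl i), Inl (Inr j)} | i j. i < k \<and> j < n - k - 1}
    \<union> {{Inl (Inl i), Inr (Inr j)} | i j. i < k \<and> j < k}
    \<union> {{Inr (Inl i), Inl (Inr j)} | i j. i < n - k \<and> j < n - k - 1}"
proof -
  have img: "g ` {F i j | i j. P i j} = {g (F i j) | i j. P i j}" for g F P by auto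
  have "{{Inl x, Inr y} | x y. x \<in> Inl ` {..<k} \<and> y \<in> Inr ` {..<k}} =
      ({{Inl (Inl i), Inr (Inr j)} | i j. i < k \<and> j < k} :: ((nat + nat) + (nat + nat)) set set)"
    by blast
  moreover have "{{Inl y, Inr x} | y x. y \<in> Inr ` {..<n - k - 1} \<and> x \<in> Inl ` {..<n - k}} =
      ({{Inr (Inl i), Inl (Inr j)} | i j. i < n - k \<and> j < n - k - 1} ::
        ((nat + nat) + (nat + nat)) set set)"
    unfolding insert_commute[of "Inr (Inl _)"] by blast
  ultimately show ?thesis
    by (simp add: S_graph_def bip_join_def complete_bip_def edgeless_bip_def img)
qed

lemma edges_T_graph:
  "edges (T_graph n 0) = {{Inr (Inl i), Inl (Inr j)} | i j. i < n - 1 \<and> j < n - 1}"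
proof -
  have "{{Inl y, Inr x} | y x. y \<in> Inr ` {..<n - 1} \<and> x \<in> Inl ` {..<n - 1}} =
      {{Inr (Inl i), Inl (Inr j)} | i j. i < n - 1 \<and> j < n - 1}"
    unfolding insert_commute[of "Inr (Inl _)"] by blast
  then show ?thesis
    by (simp add: T_graph_def bip_join_def complete_bip_def edgeless_bip_def)
qed

lemma half_join_S_graph:
  assumes "n \<ge> 2 * k + 1"
  shows "half_join (S_graph n k) (Inl ` Inl ` {..<k}) (Inl ` Inr ` {..<n - k - 1})"
    and "card (Xpart (S_graph n k)) = n" "card (Ypart (S_graph n k)) = n - 1"
proof -
  have X: "Xpart (S_graph n k) = Inl ` Inl ` {..<k} \<union> Inr ` Inl ` {..<n - k}"
    and Y: "Ypart (S_graph n k) = Inl ` Inr ` {..<n - k - 1} \<union> Inr ` Inr ` {..<k}"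
    by (auto simp: S_graph_def bip_join_def complete_bip_def edgeless_bip_def Plus_def)
  show "half_join (S_graph n k) (Inl ` Inl ` {..<k}) (Inl ` Inr ` {..<n - k - 1})"
    unfolding half_join_def bipartite_graph_def X Y edges_S_graph
  proof (intro conjI ballI)
    show "{{Inl (Inl i), Inl (Inr j)} | i j. i < k \<and> j < n - k - 1}
        \<union> {{Inl (Inl i), Inr (Inr j)} | i j. i < k \<and> j < k}
        \<union> {{Inr (Inl i), Inl (Inr j)} | i j. i < n - k \<and> j < n - k - 1}
      \<subseteq> {{x, y} | x y. x \<in> Inl ` Inl ` {..<k} \<union> Inr ` Inl ` {..<n - k} \<and>
          y \<in> Inl ` Inr ` {..<n - k - 1} \<union> Inr ` Inr ` {..<k}}"
      by blast
  qed (auto simp: doubleton_eq_iff)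
  show "card (Xpart (S_graph n k)) = n" "card (Ypart (S_graph n k)) = n - 1"
    unfolding X Y using assms
    by (subst card_Un_disjoint; auto simp: card_image inj_on_def image_image)+
qed

text \<open>For \<open>k = 0\<close> the complete block has an empty first part, so the graph is
  complete bipartite with parts of size \<open>n - 1\<close>, plus an isolated vertex in
  \<open>Ypart\<close>. Hence \<open>Ypart\<close> is the larger part here, unlike in
  \<open>S_graph\<close>.\<close>

lemma half_join_T_graph:
  assumes "n \<ge> 1"
  shows "half_join (T_graph n 0) {} (Inl ` Inr ` {..<n - 1})"
    and "card (Xpart (T_graph n 0)) = n - 1" "card (Ypart (T_graph n 0)) = n"
proof -
  have X: "Xpart (T_graph n 0) = Inr ` Inl ` {..<n - 1}"
    and Y: "Ypart (T_graph n 0) = Inl ` Inr ` {..<n - 1} \<union> Inr ` Inr ` {..<1}"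
    by (auto simp: T_graph_def bip_join_def complete_bip_def edgeless_bip_def Plus_def)
  show "half_join (T_graph n 0) {} (Inl ` Inr ` {..<n - 1})"
    unfolding half_join_def bipartite_graph_def X Y edges_T_graph
  proof (intro conjI ballI)
    show "{{Inr (Inl i), Inl (Inr j)} | i j. i < n - 1 \<and> j < n - 1}
      \<subseteq> {{x, y} | x y. x \<in> Inr ` Inl ` {..<n - 1} \<and>
          y \<in> Inl ` Inr ` {..<n - 1} \<union> Inr ` Inr ` {..<1}}"
      by blast
  qed (auto simp: doubleton_eq_iff)
  show "card (Xpart (T_graph n 0)) = n - 1" "card (Ypart (T_graph n 0)) = n"
    unfolding X Y using assms
    by (subst card_Un_disjoint; auto simp: card_image inj_on_def image_image | simp add: card_image inj_on_def image_image)+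
qed

text \<open>The non-isolated vertices induce a regular graph of degree \<open>n - 1\<close>, so
  their indicator function is an eigenfunction.\<close>

lemma rho_T_graph_ge:
  assumes "n \<ge> 2"
  shows "real (n - 1) \<le> rho (T_graph n 0)"
proof -
  let ?G = "T_graph n 0"
  let ?B = "Inl ` Inr ` {..<n - 1} :: ((nat + nat) + (nat + nat)) set"
  note T = half_join_T_graph[of n]
  have G: "half_join ?G {} ?B" using T assms by simp
  have bip: "bipartite_graph ?G" and fin: "finite (Xpart ?G)" "finite (Ypart ?G)"
    and disj: "Xpart ?G \<inter> Ypart ?G = {}" and sub: "?B \<subseteq> Ypart ?G"
    and E: "\<And>x y. x \<in> Xpart ?G \<Longrightarrow> y \<in> Ypart ?G \<Longrightarrow> {x, y} \<in> edges ?G \<longleftrightarrow> y \<in> ?B"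
    using G by (auto simp: half_join_def bipartite_graph_def)
  have cB: "card ?B = n - 1" by (simp add: image_image card_image inj_on_def)
  define z where "z v = (of_bool (v \<in> Xpart ?G \<or> v \<in> ?B) :: real)" for v
  have "eigenfunction ?G (real (n - 1)) z"
  proof (rule eigenfunction_bipartiteI[OF bip])
    have "Xpart ?G \<noteq> {}" using T(2) assms by auto
    then show "\<exists>v\<in>verts ?G. z v \<noteq> 0" by (auto simp: z_def verts_def)
  next
    fix x assume x: "x \<in> Xpart ?G"
    have "(\<Sum>y\<in>Ypart ?G. if {x, y} \<in> edges ?G then z y else 0) = (\<Sum>y\<in>Ypart ?G. if y \<in> ?B then 1 else 0)"
      using E x by (intro sum.cong) (auto simp: z_def)
    then show "(\<Sum>y\<in>Ypart ?G. if {x, y} \<in> edges ?G then z y else 0) = real (n - 1) * z x"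
      using sum_split_subset[OF fin(2) sub, of 1 0] x cB by (simp add: z_def)
  next
    fix y assume y: "y \<in> Ypart ?G"
    have "(\<Sum>x\<in>Xpart ?G. if {x, y} \<in> edges ?G then z x else 0) = (\<Sum>x\<in>Xpart ?G. of_bool (y \<in> ?B))"
      using E y by (intro sum.cong) (auto simp: z_def)
    moreover have "y \<notin> Xpart ?G" using y disj by auto
    ultimately show "(\<Sum>x\<in>Xpart ?G. if {x, y} \<in> edges ?G then z x else 0) = real (n - 1) * z y"
      using T(2) assms by (simp add: z_def)
  qed
  moreover have "finite (verts ?G)" using fin by (simp add: verts_def)
  ultimately show ?thesis by (rule rho_upper[rotated])
qed

section \<open>Counting non-edges\<close>

definition nonedges :: "'a bigraph \<Rightarrow> ('a \<times> 'a) set" where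
  "nonedges G = {(x, y). x \<in> Xpart G \<and> y \<in> Ypart G \<and> {x, y} \<notin> edges G}"

lemma finite_nonedges: "bipartite_graph G \<Longrightarrow> finite (nonedges G)"
  by (rule finite_subset[of _ "Xpart G \<times> Ypart G"]) (auto simp: nonedges_def bipartite_graph_def)

lemma card_edges_nonedges:
  assumes "bipartite_graph G"
  shows "card (edge_pairs G) + card (nonedges G) = card (Xpart G) * card (Ypart G)"
proof -
  have fin: "finite (Xpart G)" "finite (Ypart G)" using assms by (auto simp: bipartite_graph_def)
  have U: "edge_pairs G \<union> nonedges G = Xpart G \<times> Ypart G" "edge_pairs G \<inter> nonedges G = {}"
    by (auto simp: edge_pairs_def nonedges_def)
  then have "finite (edge_pairs G)" "finite (nonedges G)"
    using fin by (metis finite_SigmaI finite_Un)+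
  then show ?thesis using U card_Un_disjoint[of "edge_pairs G" "nonedges G"]
    by (simp add: card_cartesian_product)
qed

lemma vertex_degree_X:
  assumes "bipartite_graph G" "x \<in> Xpart G"
  shows "vertex_degree G x + card {y \<in> Ypart G. {x, y} \<notin> edges G} = card (Ypart G)"
proof -
  have "{u \<in> verts G. {u, x} \<in> edges G} = {y \<in> Ypart G. {x, y} \<in> edges G}"
    using assms bipartite_edgeD[OF assms(1), of _ x]
    by (auto simp: verts_def bipartite_graph_def insert_commute)
  moreover have "finite (Ypart G)" using assms by (simp add: bipartite_graph_def)
  then have "card {y \<in> Ypart G. {x, y} \<in> edges G} + card {y \<in> Ypart G. {x, y} \<notin> edges G} = card (Ypart G)"
    by (subst card_Un_disjoint[symmetric]) (auto intro!: arg_cong[of _ _ card])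
  ultimately show ?thesis by (simp add: vertex_degree_def)
qed

lemma vertex_degree_Y:
  assumes "bipartite_graph G" "y \<in> Ypart G"
  shows "vertex_degree G y + card {x \<in> Xpart G. {x, y} \<notin> edges G} = card (Xpart G)"
proof -
  have "{u \<in> verts G. {u, y} \<in> edges G} = {x \<in> Xpart G. {x, y} \<in> edges G}"
    using assms bipartite_edgeD[OF assms(1), of _ y]
    by (auto simp: verts_def bipartite_graph_def)
  moreover have "finite (Xpart G)" using assms by (simp add: bipartite_graph_def)
  then have "card {x \<in> Xpart G. {x, y} \<in> edges G} + card {x \<in> Xpart G. {x, y} \<notin> edges G} = card (Xpart G)"
    by (subst card_Un_disjoint[symmetric]) (auto intro!: arg_cong[of _ _ card])
  ultimately show ?thesis by (simp add: vertex_degree_def)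
qed

lemma card_nonedges_ge_X:
  assumes G: "bipartite_graph G" and S: "S \<subseteq> Xpart G"
    and d: "\<And>x. x \<in> S \<Longrightarrow> vertex_degree G x + c \<le> card (Ypart G)"
  shows "card S * c \<le> card {p \<in> nonedges G. fst p \<in> S}"
proof -
  have fin: "finite S" "finite (Ypart G)" using S G by (auto simp: bipartite_graph_def finite_subset)
  have "{p \<in> nonedges G. fst p \<in> S} = (SIGMA x:S. {y \<in> Ypart G. {x, y} \<notin> edges G})"
    using S by (auto simp: nonedges_def)
  then have "card {p \<in> nonedges G. fst p \<in> S} = (\<Sum>x\<in>S. card {y \<in> Ypart G. {x, y} \<notin> edges G})"
    using fin by (simp add: card_SigmaI)
  also have "\<dots> \<ge> (\<Sum>x\<in>S. c)"
  proof (rule sum_mono)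
    show "c \<le> card {y \<in> Ypart G. {x, y} \<notin> edges G}" if "x \<in> S" for x
      using d[OF that] vertex_degree_X[OF G subsetD[OF S that]] by linarith
  qed
  finally show ?thesis by simp
qed

lemma card_nonedges_ge_Y:
  assumes G: "bipartite_graph G" and S: "S \<subseteq> Ypart G"
    and d: "\<And>y. y \<in> S \<Longrightarrow> vertex_degree G y + c \<le> card (Xpart G)"
  shows "card S * c \<le> card {p \<in> nonedges G. snd p \<in> S}"
proof -
  have fin: "finite S" "finite (Xpart G)" using S G by (auto simp: bipartite_graph_def finite_subset)
  have "bij_betw (\<lambda>(y, x). (x, y)) (SIGMA y:S. {x \<in> Xpart G. {x, y} \<notin> edges G})
      {p \<in> nonedges G. snd p \<in> S}"
    using S by (intro bij_betwI[of _ _ _ "\<lambda>(x, y). (y, x)"]) (auto simp: nonedges_def)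
  then have "card {p \<in> nonedges G. snd p \<in> S} = (\<Sum>y\<in>S. card {x \<in> Xpart G. {x, y} \<notin> edges G})"
    using fin by (simp add: card_SigmaI flip: bij_betw_same_card)
  also have "\<dots> \<ge> (\<Sum>y\<in>S. c)"
  proof (rule sum_mono)
    show "c \<le> card {x \<in> Xpart G. {x, y} \<notin> edges G}" if "y \<in> S" for y
      using d[OF that] vertex_degree_Y[OF G subsetD[OF S that]] by linarith
  qed
  finally show ?thesis by simp
qed

text \<open>The degree sum is maximised over non-adjacent pairs across the parts; with one end of
  the best pair fixed, the other end has maximal degree among its competitors.\<close>

lemma maximal_degree_sum_pair:
  assumes H: "bipartite_graph H"
    and ex: "\<exists>x\<in>Xpart H. \<exists>y\<in>Ypart H. {x, y} \<notin> edges H"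
  obtains x y where "x \<in> Xpart H" "y \<in> Ypart H" "{x, y} \<notin> edges H"
    and "\<And>x'. x' \<in> Xpart H \<Longrightarrow> {x', y} \<notin> edges H \<Longrightarrow> vertex_degree H x' \<le> vertex_degree H x"
    and "\<And>y'. y' \<in> Ypart H \<Longrightarrow> {x, y'} \<notin> edges H \<Longrightarrow> vertex_degree H y' \<le> vertex_degree H y"
proof -
  define w where "w = (\<lambda>(x, y). vertex_degree H x + vertex_degree H y)"
  have ne: "nonedges H \<noteq> {}" using ex by (auto simp: nonedges_def)
  have fin: "finite (w ` nonedges H)" using finite_nonedges[OF H] by simp
  then have "Max (w ` nonedges H) \<in> w ` nonedges H" using ne by (intro Max_in) auto
  then obtain p where p: "p \<in> nonedges H" "\<And>q. q \<in> nonedges H \<Longrightarrow> w q \<le> w p"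
    using Max_ge[OF fin] by (metis imageE imageI)
  obtain x y where xy: "p = (x, y)" by (cases p)
  show thesis
  proof (rule that[of x y])
    show "x \<in> Xpart H" "y \<in> Ypart H" "{x, y} \<notin> edges H"
      using p(1) by (auto simp: nonedges_def xy)
    show "vertex_degree H x' \<le> vertex_degree H x" if "x' \<in> Xpart H" "{x', y} \<notin> edges H" for x'
      using p(2)[of "(x', y)"] that p(1) by (auto simp: nonedges_def xy w_def)
    show "vertex_degree H y' \<le> vertex_degree H y" if "y' \<in> Ypart H" "{x, y'} \<notin> edges H" for y'
      using p(2)[of "(x, y')"] that p(1) by (auto simp: nonedges_def xy w_def)
  qed
qed

text \<open>Each of the \<open>n - vertex_degree H y\<close> non-neighbours of \<open>y\<close> in
  \<open>Xpart H\<close> has degree at most that of \<open>x\<close>, so it lies in at least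
  \<open>n - 1 - vertex_degree H x\<close> non-edges. By the degree-sum bound the first number is at
  least \<open>vertex_degree H x + 1\<close>.\<close>

lemma maximal_degree_sum_pair_count:
  assumes H: "bipartite_graph H" and cards: "card (Xpart H) = n" "card (Ypart H) = n - 1" "n \<ge> 1"
    and closed: "\<And>x y. x \<in> Xpart H \<Longrightarrow> y \<in> Ypart H \<Longrightarrow> {x, y} \<notin> edges H \<Longrightarrow>
      vertex_degree H x + vertex_degree H y \<le> n - 1"
    and ex: "\<exists>x\<in>Xpart H. \<exists>y\<in>Ypart H. {x, y} \<notin> edges H"
  obtains x y where "x \<in> Xpart H" "y \<in> Ypart H" "{x, y} \<notin> edges H"
    and "(n - vertex_degree H y) * (n - 1 - vertex_degree H x) \<le> card (nonedges H)"
    and "(vertex_degree H x + 1) * (n - 1 - vertex_degree H x) \<le> card (nonedges H)"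
    and "\<And>y'. y' \<in> Ypart H \<Longrightarrow> {x, y'} \<notin> edges H \<Longrightarrow> vertex_degree H y' \<le> vertex_degree H y"
proof -
  obtain x y where xy: "x \<in> Xpart H" "y \<in> Ypart H" "{x, y} \<notin> edges H"
    and mx: "\<And>x'. x' \<in> Xpart H \<Longrightarrow> {x', y} \<notin> edges H \<Longrightarrow> vertex_degree H x' \<le> vertex_degree H x"
    and my: "\<And>y'. y' \<in> Ypart H \<Longrightarrow> {x, y'} \<notin> edges H \<Longrightarrow> vertex_degree H y' \<le> vertex_degree H y"
    using maximal_degree_sum_pair[OF H ex] by blast
  define S where "S = {x' \<in> Xpart H. {x', y} \<notin> edges H}"
  have cS: "card S = n - vertex_degree H y"
    using vertex_degree_Y[OF H xy(2)] cards by (simp add: S_def)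
  have le: "vertex_degree H x + vertex_degree H y \<le> n - 1" using closed xy by blast
  have "card S * (n - 1 - vertex_degree H x) \<le> card {p \<in> nonedges H. fst p \<in> S}"
  proof (rule card_nonedges_ge_X[OF H])
    show "vertex_degree H x' + (n - 1 - vertex_degree H x) \<le> card (Ypart H)" if "x' \<in> S" for x'
      using mx[of x'] that le cards by (simp add: S_def)
  qed (simp add: S_def)
  also have "\<dots> \<le> card (nonedges H)"
    using finite_nonedges[OF H] by (intro card_mono) auto
  finally have 1: "(n - vertex_degree H y) * (n - 1 - vertex_degree H x) \<le> card (nonedges H)"
    by (simp add: cS)
  have "vertex_degree H x + 1 \<le> n - vertex_degree H y" using le cards(3) by simp
  then have "(vertex_degree H x + 1) * (n - 1 - vertex_degree H x) \<le> card (nonedges H)"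
    using 1 by (meson mult_le_mono1 le_trans)
  then show thesis using that[OF xy 1 _ my] by blast
qed

section \<open>Structure of edge-maximal graphs with few non-edges\<close>

text \<open>The count forces degree \<open>n - 1 - k\<close> for \<open>x\<close>, and its
  \<open>k\<close> non-neighbours \<open>Z\<close> already account for almost all non-edges. The
  degree-sum bound excludes non-edges outside \<open>Z\<close>, and \<open>A\<close> becomes the set
  of common neighbours of \<open>Z\<close>.\<close>

lemma closed_graph_is_half_join:
  assumes H: "bipartite_graph H" and cards: "card (Xpart H) = n" "card (Ypart H) = n - 1"
    and k: "k \<ge> 1" and n: "n \<ge> (k + 1)\<^sup>2"
    and deg: "\<And>v. v \<in> verts H \<Longrightarrow> k \<le> vertex_degree H v"
    and closed: "\<And>x y. x \<in> Xpart H \<Longrightarrow> y \<in> Ypart H \<Longrightarrow> {x, y} \<notin> edges H \<Longrightarrow>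
      vertex_degree H x + vertex_degree H y \<le> n - 1"
    and ex: "\<exists>x\<in>Xpart H. \<exists>y\<in>Ypart H. {x, y} \<notin> edges H"
    and few: "card (nonedges H) < n * k"
  obtains A B where "half_join H A B" "card A = k" "card B = n - k - 1"
proof -
  have n': "n \<ge> k * k + 2 * k + 1" using n by (simp add: power2_eq_square algebra_simps)
  then have n1: "n \<ge> 1" by simp
  have fin: "finite (Xpart H)" "finite (Ypart H)" using H by (auto simp: bipartite_graph_def)
  obtain x y where xy: "x \<in> Xpart H" "y \<in> Ypart H" "{x, y} \<notin> edges H"
    and cnt: "(vertex_degree H x + 1) * (n - 1 - vertex_degree H x) \<le> card (nonedges H)"
    and my: "\<And>y'. y' \<in> Ypart H \<Longrightarrow> {x, y'} \<notin> edges H \<Longrightarrow> vertex_degree H y' \<le> vertex_degree H y"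
    using maximal_degree_sum_pair_count[OF H cards n1 closed ex] by blast
  define s where "s = vertex_degree H x"
  define t where "t = vertex_degree H y"
  have st: "s + t \<le> n - 1" "k \<le> s" "k \<le> t"
    using closed[OF xy] deg xy by (auto simp: s_def t_def verts_def)
  have s: "s = n - 1 - k"
  \<comment> \<open>Otherwise \<open>k <= s <= n - 2 - k\<close>. By concavity
    \<open>(s + 1) * (n - 1 - s)\<close> is at least its common value
    \<open>(k + 1) * (n - 1 - k)\<close> at both ends, which equals
    \<open>n * k + n - (k + 1)^2\<close>.\<close>
  proof (rule ccontr)
    assume "s \<noteq> n - 1 - k"
    then have "s + k + 2 \<le> n" using st by linarith
    then obtain b where b: "n = s + k + 2 + b" using le_Suc_ex by blast
    obtain a where a: "s = k + a" using st(2) le_Suc_ex by blast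
    have "n * k \<le> (k + 1) * (n - 1 - k)"
    proof -
      obtain c where "n = k * k + 2 * k + 1 + c" using n' le_Suc_ex by blast
      then show ?thesis by (simp add: algebra_simps)
    qed
    also have "\<dots> \<le> (s + 1) * (n - 1 - s)" by (simp add: a b algebra_simps)
    also have "\<dots> < n * k" using cnt few by (simp add: s_def)
    finally show False by simp
  qed
  have t: "t = k" using s st n' by simp
  define Z where "Z = {y' \<in> Ypart H. {x, y'} \<notin> edges H}"
  define B where "B = Ypart H - Z"
  have ZY: "Z \<subseteq> Ypart H" by (auto simp: Z_def)
  have finZ: "finite Z" "finite B" using fin by (simp_all add: Z_def B_def)
  have cZ: "card Z = k"
    using vertex_degree_X[OF H xy(1)] cards s n' by (simp add: Z_def s_def)
  have cB: "card B = n - k - 1"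
    using card_Diff_subset[OF finZ(1) ZY] cZ cards by (simp add: B_def)
  \<comment> \<open>By the choice of the pair, a non-neighbour of \<open>x\<close> has degree at
    most \<open>t = k\<close>, hence exactly \<open>k\<close>.\<close>
  have degZ: "vertex_degree H z = k" if "z \<in> Z" for z
    using my[of z] deg[of z] that t by (auto simp: Z_def t_def verts_def)
  define MZ where "MZ = {p \<in> nonedges H. snd p \<in> Z}"
  define MB where "MB = {p \<in> nonedges H. snd p \<in> B}"
  have finM: "finite MZ" "finite MB" using finite_nonedges[OF H] by (simp_all add: MZ_def MB_def)
  \<comment> \<open>Each vertex of \<open>Z\<close> has \<open>n - k\<close> non-neighbours, so
    fewer than \<open>n * k - k * (n - k) = k * k\<close> non-edges are left at
    \<open>B\<close>.\<close>
  have "k * (n - k) \<le> card MZ"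
    using card_nonedges_ge_Y[OF H ZY, of "n - k"] degZ cards n' by (simp add: cZ MZ_def)
  moreover have "nonedges H = MZ \<union> MB" "MZ \<inter> MB = {}"
    by (auto simp: MZ_def MB_def B_def nonedges_def)
  then have "card (nonedges H) = card MZ + card MB"
    using finM by (simp add: card_Un_disjoint)
  moreover have "k * (n - k) + k * k = n * k"
    unfolding add_mult_distrib2[symmetric] using n' by simp
  ultimately have MBk: "card MB < k * k" using few by linarith
  \<comment> \<open>A missing edge at \<open>B\<close> would, by the degree-sum bound, come with at least
    \<open>n - 1 - k \<ge> k\<^sup>2 + k\<close> missing edges at \<open>B\<close>.\<close>
  have complete: "{w, y1} \<in> edges H" if w: "w \<in> Xpart H" and y1: "y1 \<in> B" for w y1
  proof (rule ccontr)
    assume no: "{w, y1} \<notin> edges H"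
    have y1Y: "y1 \<in> Ypart H" using y1 by (simp add: B_def)
    define R where "R = {y' \<in> B. {w, y'} \<notin> edges H}"
    define C where "C = {x' \<in> Xpart H. {x', y1} \<notin> edges H}"
    have finRC: "finite R" "finite C" using finZ fin by (simp_all add: R_def C_def)
    have "{y' \<in> Ypart H. {w, y'} \<notin> edges H} \<subseteq> R \<union> Z" by (auto simp: R_def B_def)
    then have "card {y' \<in> Ypart H. {w, y'} \<notin> edges H} \<le> card (R \<union> Z)"
      using finRC finZ by (intro card_mono) auto
    also have "\<dots> \<le> card R + k" using card_Un_le[of R Z] cZ by simp
    finally have "card {y' \<in> Ypart H. {w, y'} \<notin> edges H} \<le> card R + k" .
    then have r: "n - 1 \<le> vertex_degree H w + card R + k"
      using vertex_degree_X[OF H w] cards by simp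
    have c: "vertex_degree H y1 + card C = n"
      using vertex_degree_Y[OF H y1Y] cards by (simp add: C_def)
    \<comment> \<open>The missing edges at \<open>w\<close> and those at \<open>y1\<close> have at
      most the pair \<open>(w, y1)\<close> in common.\<close>
    have "card R + card C = card (Pair w ` R) + card ((\<lambda>x'. (x', y1)) ` C)"
      by (simp add: card_image inj_on_def)
    also have "\<dots> = card (Pair w ` R \<union> (\<lambda>x'. (x', y1)) ` C) + card (Pair w ` R \<inter> (\<lambda>x'. (x', y1)) ` C)"
      using finRC by (intro card_Un_Int) auto
    also have "\<dots> \<le> card MB + card {(w, y1)}"
      using w y1 y1Y finM
      by (intro add_mono card_mono) (auto simp: MB_def nonedges_def R_def C_def B_def)
    finally show False
      using r c closed[OF w y1Y no] MBk n' by simp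
  qed
  define A where "A = {w \<in> Xpart H. \<forall>z\<in>Z. {w, z} \<in> edges H}"
  \<comment> \<open>If \<open>w\<close> misses a vertex of \<open>Z\<close>, the degree-sum bound
    makes it miss at least \<open>k\<close> vertices. All of them lie in \<open>Z\<close>, which has
    only \<open>k\<close> elements.\<close>
  have all_or_none: "{w, z'} \<notin> edges H"
    if w: "w \<in> Xpart H" and z: "z \<in> Z" "{w, z} \<notin> edges H" "z' \<in> Z" for w z z'
  proof -
    have "vertex_degree H w + k \<le> n - 1" using closed[OF w _ z(2)] degZ[OF z(1)] ZY z(1) by auto
    then have "k \<le> card {y' \<in> Ypart H. {w, y'} \<notin> edges H}"
      using vertex_degree_X[OF H w] cards by simp
    moreover have "{y' \<in> Ypart H. {w, y'} \<notin> edges H} \<subseteq> Z"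
      using complete[OF w] by (auto simp: B_def)
    ultimately have "{y' \<in> Ypart H. {w, y'} \<notin> edges H} = Z"
      using card_seteq[OF finZ(1)] cZ by simp
    then show ?thesis using z(3) by auto
  qed
  have "half_join H A B"
    unfolding half_join_def
  proof (intro conjI ballI)
    fix w v assume wv: "w \<in> Xpart H" "v \<in> Ypart H"
    show "{w, v} \<in> edges H \<longleftrightarrow> w \<in> A \<or> v \<in> B"
    proof (cases "v \<in> B")
      case False
      then have "v \<in> Z" using wv by (simp add: B_def)
      have "{w, v} \<in> edges H \<longleftrightarrow> w \<in> A"
        using all_or_none[OF wv(1) _ _ \<open>v \<in> Z\<close>] \<open>v \<in> Z\<close> wv(1) unfolding A_def by blast
      then show ?thesis using False by simp
    qed (use complete wv in auto)
  qed (use H in \<open>auto simp: A_def B_def\<close>)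
  moreover have "card A = k"
  proof -
    \<comment> \<open>Since \<open>y\<close> is in \<open>Z\<close>, the set \<open>A\<close> is
      exactly the neighbourhood of \<open>y\<close>, whose degree is \<open>k\<close>.\<close>
    have yZ: "y \<in> Z" using xy by (simp add: Z_def)
    have "A = Xpart H - {w \<in> Xpart H. {w, y} \<notin> edges H}"
      using all_or_none[OF _ _ _ yZ] yZ unfolding A_def by blast
    moreover have "card (Xpart H - {w \<in> Xpart H. {w, y} \<notin> edges H}) =
        n - card {w \<in> Xpart H. {w, y} \<notin> edges H}"
      using fin cards by (subst card_Diff_subset) auto
    ultimately show ?thesis
      using vertex_degree_Y[OF H xy(2)] degZ[OF yZ] cards by simp
  qed
  ultimately show thesis using that cB by blast
qed

text \<open>With \<open>s\<close> the degree of \<open>x\<close>, the count reads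
  \<open>(n - 1) + s * (n - 2 - s) <= n - 1\<close>, so \<open>s = 0\<close> or
  \<open>s = n - 2\<close>. Either way one vertex lies in \<open>n - 1\<close> non-edges, which must
  be all of them.\<close>

lemma closed_graph_few_nonedges:
  assumes H: "bipartite_graph H" and cards: "card (Xpart H) = n" "card (Ypart H) = n - 1" "n \<ge> 2"
    and closed: "\<And>x y. x \<in> Xpart H \<Longrightarrow> y \<in> Ypart H \<Longrightarrow> {x, y} \<notin> edges H \<Longrightarrow>
      vertex_degree H x + vertex_degree H y \<le> n - 1"
    and ex: "\<exists>x\<in>Xpart H. \<exists>y\<in>Ypart H. {x, y} \<notin> edges H"
    and few: "card (nonedges H) \<le> n - 1"
  shows "card (nonedges H) = n - 1 \<and>
    ((\<exists>A. half_join H A {} \<and> card A = n - 1) \<or>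
     (\<exists>A B. half_join H A B \<and> card A = 1 \<and> card B = n - 2 \<and> n \<ge> 3))"
proof -
  have fin: "finite (Xpart H)" "finite (Ypart H)" using H by (auto simp: bipartite_graph_def)
  have n1: "n \<ge> 1" using cards(3) by simp
  obtain x y where xy: "x \<in> Xpart H" "y \<in> Ypart H" "{x, y} \<notin> edges H"
    and cnt1: "(n - vertex_degree H y) * (n - 1 - vertex_degree H x) \<le> card (nonedges H)"
    and cnt: "(vertex_degree H x + 1) * (n - 1 - vertex_degree H x) \<le> card (nonedges H)"
    using maximal_degree_sum_pair_count[OF H cards(1,2) n1 closed ex] by blast
  define s where "s = vertex_degree H x"
  define t where "t = vertex_degree H y"
  have st: "s + t \<le> n - 1" using closed[OF xy] by (simp add: s_def t_def)
  have "card {y' \<in> Ypart H. {x, y'} \<notin> edges H} \<noteq> 0" using xy fin by auto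
  then have s2: "s + 2 \<le> n" using vertex_degree_X[OF H xy(1)] cards by (simp add: s_def)
  have cnt': "(s + 1) * (n - 1 - s) \<le> n - 1" using cnt few by (simp add: s_def)
  show ?thesis
  proof (cases "s = 0")
    case True
    define P where "P = {x} \<times> Ypart H"
    have "{y' \<in> Ypart H. {x, y'} \<notin> edges H} = Ypart H"
      using vertex_degree_X[OF H xy(1)] True fin by (intro card_seteq) (auto simp: s_def)
    then have "P \<subseteq> nonedges H" using xy by (auto simp: P_def nonedges_def)
    moreover have "card P = n - 1" using cards by (simp add: P_def card_cartesian_product)
    ultimately have N: "nonedges H = P"
      using few finite_nonedges[OF H] by (metis card_seteq)
    have "half_join H (Xpart H - {x}) {}"
      unfolding half_join_def
    proof (intro conjI ballI)
      fix x' y' assume "x' \<in> Xpart H" "y' \<in> Ypart H"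
      then have "(x', y') \<in> nonedges H \<longleftrightarrow> {x', y'} \<notin> edges H" by (simp add: nonedges_def)
      then show "{x', y'} \<in> edges H \<longleftrightarrow> x' \<in> Xpart H - {x} \<or> y' \<in> {}"
        using \<open>x' \<in> Xpart H\<close> \<open>y' \<in> Ypart H\<close> by (auto simp: N P_def)
    qed (use H in auto)
    moreover have "card (Xpart H - {x}) = n - 1" using xy fin cards by simp
    ultimately show ?thesis using N \<open>card P = n - 1\<close> by auto
  next
    case False
    then have "s \<ge> 1" by simp
    then obtain a where a: "s = a + 1" using le_Suc_ex[of 1 s] by auto
    obtain b where b: "n = s + 2 + b" using s2 le_Suc_ex by blast
    have "b = 0" using cnt' by (simp add: a b)
    then have n: "n = s + 2" "n \<ge> 3" using b a by simp_all
    \<comment> \<open>The first count gives \<open>t >= 1\<close> and the degree sum gives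
      \<open>t <= 1\<close>, so \<open>y\<close> has \<open>n - 1\<close> non-neighbours.\<close>
    have "n - t \<le> n - 1" using cnt1 few n by (simp add: s_def t_def)
    then have t: "t = 1" using st n by simp
    define D where "D = {x' \<in> Xpart H. {x', y} \<notin> edges H}"
    define P where "P = D \<times> {y}"
    have cD: "card D = n - 1" using vertex_degree_Y[OF H xy(2)] t cards by (simp add: D_def t_def)
    have "P \<subseteq> nonedges H" using xy by (auto simp: P_def D_def nonedges_def)
    moreover have "card P = n - 1" using cD by (simp add: P_def card_cartesian_product)
    ultimately have N: "nonedges H = P"
      using few finite_nonedges[OF H] by (metis card_seteq)
    have "half_join H (Xpart H - D) (Ypart H - {y})"
      unfolding half_join_def
    proof (intro conjI ballI)
      fix x' y' assume "x' \<in> Xpart H" "y' \<in> Ypart H"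
      then have "(x', y') \<in> nonedges H \<longleftrightarrow> {x', y'} \<notin> edges H" by (simp add: nonedges_def)
      then show "{x', y'} \<in> edges H \<longleftrightarrow> x' \<in> Xpart H - D \<or> y' \<in> Ypart H - {y}"
        using \<open>x' \<in> Xpart H\<close> \<open>y' \<in> Ypart H\<close> by (auto simp: N P_def)
    qed (use H in auto)
    moreover have "card (Xpart H - D) = 1"
      using fin cards cD n by (subst card_Diff_subset) (auto simp: D_def)
    moreover have "card (Ypart H - {y}) = n - 2" using xy fin cards by simp
    ultimately show ?thesis using N \<open>card P = n - 1\<close> n by blast
  qed
qed

section \<open>Spectral condition for traceability\<close>

definition swap_parts :: "'a bigraph \<Rightarrow> 'a bigraph" where
  "swap_parts G = \<lparr>Xpart = Ypart G, Ypart = Xpart G, edges = edges G\<rparr>"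

lemma swap_parts_simps [simp]:
  "Xpart (swap_parts G) = Ypart G" "Ypart (swap_parts G) = Xpart G"
  "edges (swap_parts G) = edges G" "verts (swap_parts G) = verts G"
  by (auto simp: swap_parts_def verts_def)

lemma bipartite_graph_swap_parts: "bipartite_graph (swap_parts G) \<longleftrightarrow> bipartite_graph G"
proof -
  have "{{x, y} | x y. x \<in> Ypart G \<and> y \<in> Xpart G} = {{x, y} | x y. x \<in> Xpart G \<and> y \<in> Ypart G}"
    by (blast intro: insert_commute)
  then show ?thesis by (auto simp: bipartite_graph_def Int_commute)
qed

text \<open>Both graphs have the same \<open>verts\<close> and \<open>edges\<close>, hence literally
  the same adjacency matrix.\<close>

lemma swap_parts_invariants:
  "rho (swap_parts G) = rho G" "traceable (swap_parts G) = traceable G"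
  "vertex_degree (swap_parts G) = vertex_degree G"
  by (auto simp: rho_def adjacency_matrix_def traceable_def vertex_degree_def fun_eq_iff)

lemma swap_parts_iso: "swap_parts G \<cong>\<^sub>b H \<longleftrightarrow> G \<cong>\<^sub>b H"
  by (auto simp: bigraph_iso_def)

lemma half_join_swap_parts:
  assumes "half_join G A B"
  shows "half_join (swap_parts G) B A"
  using assms unfolding half_join_def bipartite_graph_swap_parts swap_parts_simps
  by (metis insert_commute)

lemma half_join_edges_cong:
  assumes "half_join H A B" "bipartite_graph G"
    and "Xpart H = Xpart G" "Ypart H = Ypart G" "edges G = edges H"
  shows "half_join G A B"
  using assms by (simp add: half_join_def)

lemma nonedges_closure:
  assumes "bipartite_graph G" "Xpart H = Xpart G" "Ypart H = Ypart G" "edges G \<subseteq> edges H"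
  shows "card (nonedges H) \<le> card (nonedges G)"
  using assms by (intro card_mono finite_nonedges) (auto simp: nonedges_def)

lemma vertex_degree_mono:
  assumes "finite (verts G)" "verts H = verts G" "edges G \<subseteq> edges H"
  shows "vertex_degree G v \<le> vertex_degree H v"
  unfolding vertex_degree_def using assms by (intro card_mono) auto

section \<open>The two cases of the spectral theorem\<close>

text \<open>As an eigenvalue of \<open>S_graph n k\<close>, the number \<open>r\<close> is at most
  \<open>rho G\<close>; as the eigenvalue of a positive eigenfunction of the closure
  \<open>H\<close>, it is at least \<open>rho G\<close>. Equality makes \<open>G\<close> coincide
  with \<open>H\<close>.\<close>

lemma traceable_or_S_graph:
  fixes G :: "'a bigraph"
  assumes G: "bipartite_graph G" and cards: "card (Xpart G) = n" "card (Ypart G) = n - 1"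
    and k: "k \<ge> 1" and n: "n \<ge> (k + 1)\<^sup>2"
    and deg: "\<And>v. v \<in> verts G \<Longrightarrow> k \<le> vertex_degree G v"
    and rho: "rho (S_graph n k) \<le> rho G" and nt: "\<not> traceable G"
  shows "G \<cong>\<^sub>b S_graph n k"
proof -
  have n': "n \<ge> k * k + 2 * k + 1" using n by (simp add: power2_eq_square algebra_simps)
  define m where "m = n - k - 1"
  define p where "p = n - k"
  have mp: "m > 0" "p > 0" "k + p = n" "m + k = n - 1" using n' k by (simp_all add: m_def p_def)
  have k0: "0 < k" using k by simp
  have finV: "finite (verts G)" using G by (simp add: bipartite_graph_def verts_def)
  have neV: "verts G \<noteq> {}" using cards n' by (auto simp: verts_def)
  \<comment> \<open>\<open>r\<close> depends only on the sizes, so \<open>S_graph n k\<close> and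
    the graph \<open>H\<close> found below share it as an eigenvalue.\<close>
  obtain r :: real where r: "r > 0" "real ((k + p) * m) < r\<^sup>2"
    and evG: "\<And>(G :: 'a bigraph) A B. half_join G A B \<Longrightarrow> card A = k \<Longrightarrow> card (Xpart G) = k + p \<Longrightarrow>
      card B = m \<Longrightarrow> card (Ypart G) = m + k \<Longrightarrow>
      \<exists>z. eigenfunction G r z \<and> (\<forall>v\<in>verts G. z v > 0)"
    and evS: "\<And>(G :: ((nat + nat) + (nat + nat)) bigraph) A B. half_join G A B \<Longrightarrow> card A = k \<Longrightarrow>
      card (Xpart G) = k + p \<Longrightarrow> card B = m \<Longrightarrow> card (Ypart G) = m + k \<Longrightarrow>
      \<exists>z. eigenfunction G r z"
    using half_join_eigenvalue[OF k0 mp(1,2) k0, of thesis] by blast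
  let ?A = "Inl ` Inl ` {..<k} :: ((nat + nat) + (nat + nat)) set"
  let ?B = "Inl ` Inr ` {..<m} :: ((nat + nat) + (nat + nat)) set"
  have S: "half_join (S_graph n k) ?A ?B" "card (Xpart (S_graph n k)) = n"
    "card (Ypart (S_graph n k)) = n - 1"
    using half_join_S_graph[of k n] n' by (simp_all add: m_def)
  have cS: "card ?A = k" "card ?B = m" by (simp_all add: image_image card_image inj_on_def)
  have finS: "finite (verts (S_graph n k))"
    using S(1) by (simp add: half_join_def bipartite_graph_def verts_def)
  obtain zS where "eigenfunction (S_graph n k) r zS" using evS[OF S(1)] S cS mp by auto
  then have rG: "r \<le> rho G" using rho_upper[OF finS] rho by fastforce
  obtain f where f: "eigenfunction G (rho G) f" using rho_eigenvalue[OF finV neV] ..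
  \<comment> \<open>More than \<open>n * m\<close> edges out of \<open>n * (n - 1)\<close> possible
    ones leave fewer than \<open>n * k\<close> non-edges.\<close>
  have "n * m < card (edge_pairs G)"
  proof -
    have "real (n * m) < r\<^sup>2" using r mp by simp
    also have "\<dots> \<le> (rho G)\<^sup>2" using r(1) rG by (intro power_mono) auto
    also have "\<dots> \<le> real (card (edge_pairs G))" by (rule eigenvalue_square_le_edges[OF G f])
    finally show ?thesis by (simp only: of_nat_less_iff)
  qed
  moreover have "n * m + n * k = n * (n - 1)" using mp by (simp flip: add_mult_distrib2)
  ultimately have few: "card (nonedges G) < n * k"
    using card_edges_nonedges[OF G] cards by simp
  have cXY: "card (Xpart G) = card (Ypart G) + 1" using cards n' by simp
  obtain H where H: "bipartite_graph H" "Xpart H = Xpart G" "Ypart H = Ypart G"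
    "edges G \<subseteq> edges H" "\<exists>x\<in>Xpart G. \<exists>y\<in>Ypart G. {x, y} \<notin> edges H"
    and closed: "\<And>x y. x \<in> Xpart G \<Longrightarrow> y \<in> Ypart G \<Longrightarrow> {x, y} \<notin> edges H \<Longrightarrow>
      vertex_degree H x + vertex_degree H y \<le> card (Ypart G)"
    using nontraceable_closure[OF G cXY nt] by metis
  have VH: "verts H = verts G" using H by (simp add: verts_def)
  have degH: "k \<le> vertex_degree H v" if "v \<in> verts H" for v
    using deg[of v] vertex_degree_mono[OF finV VH H(4), of v] that VH by simp
  have fewH: "card (nonedges H) < n * k" using nonedges_closure[OF G H(2-4)] few by simp
  obtain A B where AB: "half_join H A B" "card A = k" "card B = n - k - 1"
    using closed_graph_is_half_join[OF H(1) _ _ k n degH _ _ fewH] H closed cards by auto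
  have ne: "A \<noteq> {}" "B \<noteq> {}" using AB k mp by (auto simp: m_def)
  obtain z where z: "eigenfunction H r z" "\<forall>v\<in>verts H. z v > 0"
    using evG[OF AB(1)] AB H cards mp by (auto simp: m_def)
  note cmp = half_join_eigenvalue_maximal[OF G AB(1) ne H(2-4) z f]
  have "edges G = edges H" using cmp rG by simp
  then have "half_join G A B" using half_join_edges_cong[OF AB(1) G H(2,3)] by simp
  then show ?thesis using half_join_iso[OF _ S(1)] AB cards S cS by (simp add: m_def)
qed

text \<open>The spectral hypothesis gives \<open>rho G >= n - 1\<close> and so leaves at most
  \<open>n - 1\<close> non-edges in \<open>G\<close>. The closure \<open>H\<close> already has that
  many, so counting alone makes \<open>G\<close> and \<open>H\<close> coincide.\<close>

lemma traceable_or_T_graph: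
  fixes G :: "'a bigraph"
  assumes G: "bipartite_graph G" and cards: "card (Xpart G) = n" "card (Ypart G) = n - 1"
    and n: "n \<ge> 2" and rho: "rho (T_graph n 0) \<le> rho G" and nt: "\<not> traceable G"
  shows "G \<cong>\<^sub>b T_graph n 0"
proof -
  have finV: "finite (verts G)" using G by (simp add: bipartite_graph_def verts_def)
  have neV: "verts G \<noteq> {}" using cards n by (auto simp: verts_def)
  obtain f where f: "eigenfunction G (rho G) f" using rho_eigenvalue[OF finV neV] ..
  have rn: "real (n - 1) \<le> rho G" using rho_T_graph_ge[OF n] rho by linarith
  have "(n - 1) * (n - 1) \<le> card (edge_pairs G)"
  proof -
    have "real ((n - 1) * (n - 1)) \<le> (rho G)\<^sup>2"
      using power_mono[OF rn, of 2] by (simp add: power2_eq_square)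
    also have "\<dots> \<le> real (card (edge_pairs G))" by (rule eigenvalue_square_le_edges[OF G f])
    finally show ?thesis by (simp only: of_nat_le_iff)
  qed
  moreover have "(n - 1) * (n - 1) + (n - 1) = n * (n - 1)"
    using n by (cases n) auto
  ultimately have few: "card (nonedges G) \<le> n - 1"
    using card_edges_nonedges[OF G] cards by simp
  have cXY: "card (Xpart G) = card (Ypart G) + 1" using cards n by simp
  obtain H where H: "bipartite_graph H" "Xpart H = Xpart G" "Ypart H = Ypart G"
    "edges G \<subseteq> edges H" "\<exists>x\<in>Xpart G. \<exists>y\<in>Ypart G. {x, y} \<notin> edges H"
    and closed: "\<And>x y. x \<in> Xpart G \<Longrightarrow> y \<in> Ypart G \<Longrightarrow> {x, y} \<notin> edges H \<Longrightarrow>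
      vertex_degree H x + vertex_degree H y \<le> card (Ypart G)"
    using nontraceable_closure[OF G cXY nt] by metis
  have fewH: "card (nonedges H) \<le> n - 1" using nonedges_closure[OF G H(2-4)] few by simp
  have st: "card (nonedges H) = n - 1 \<and>
    ((\<exists>A. half_join H A {} \<and> card A = n - 1) \<or>
     (\<exists>A B. half_join H A B \<and> card A = 1 \<and> card B = n - 2 \<and> n \<ge> 3))"
    using closed_graph_few_nonedges[OF H(1) _ _ n _ _ fewH] H closed cards by auto
  have "nonedges H \<subseteq> nonedges G" using H by (auto simp: nonedges_def)
  then have N: "nonedges H = nonedges G"
    using st few by (intro card_seteq finite_nonedges[OF G]) auto
  have E: "edges G = edges H"
  proof (rule bipartite_edges_eqI[OF G H(1-3)])
    fix x y assume "x \<in> Xpart G" "y \<in> Ypart G"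
    moreover have "(x, y) \<in> nonedges H \<longleftrightarrow> (x, y) \<in> nonedges G" by (simp add: N)
    ultimately show "{x, y} \<in> edges G \<longleftrightarrow> {x, y} \<in> edges H" using H by (simp add: nonedges_def)
  qed
  from st consider A where "half_join H A {}" "card A = n - 1"
    | A B where "half_join H A B" "card A = 1" "card B = n - 2" "n \<ge> 3" by blast
  then show ?thesis
  proof cases
    case 1
    \<comment> \<open>The isolated vertex lies in \<open>Xpart G\<close> but in the
      \<open>Ypart\<close> of \<open>T_graph n 0\<close>, hence the exchange of parts.\<close>
    have "half_join G A {}" using half_join_edges_cong[OF 1(1) G H(2,3) E] .
    then have "half_join (swap_parts G) {} A" by (rule half_join_swap_parts)
    moreover have "n \<ge> 1" using n by simp
    moreover have "card (Inl ` Inr ` {..<n - 1} :: ((nat + nat) + (nat + nat)) set) = n - 1"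
      by (simp add: image_image card_image inj_on_def)
    ultimately have "swap_parts G \<cong>\<^sub>b T_graph n 0"
      using half_join_iso[OF _ half_join_T_graph(1), of "swap_parts G" "{}" A n]
        half_join_T_graph(2,3)[of n] cards 1 by simp
    then show ?thesis by (simp add: swap_parts_iso)
  next
    case 2
    \<comment> \<open>Here \<open>H\<close> has the shape of \<open>S_graph n 1\<close>. Its
      eigenvalue satisfies \<open>r^2 < (n - 1)^2\<close>, which contradicts
      \<open>n - 1 <= rho G <= r\<close>.\<close>
    have pos: "(0 :: nat) < 1" "0 < n - 2" "0 < n - 1" using 2(4) by simp_all
    obtain r :: real where r: "r > 0" "r\<^sup>2 < real ((n - 2) * 1 + 1 * 1 + (n - 1) * (n - 2))"
      and ev: "\<And>(G :: 'a bigraph) A B. half_join G A B \<Longrightarrow> card A = 1 \<Longrightarrow>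
        card (Xpart G) = 1 + (n - 1) \<Longrightarrow> card B = n - 2 \<Longrightarrow> card (Ypart G) = n - 2 + 1 \<Longrightarrow>
        \<exists>z. eigenfunction G r z \<and> (\<forall>v\<in>verts G. z v > 0)"
      using half_join_eigenvalue[OF pos(1,2,3,1), of thesis] by blast
    have c: "card (Xpart H) = 1 + (n - 1)" "card (Ypart H) = n - 2 + 1"
      using cards H 2(4) by simp_all
    obtain z where z: "eigenfunction H r z" "\<forall>v\<in>verts H. z v > 0"
      using ev[OF 2(1,2) c(1) 2(3) c(2)] by blast
    have ne: "A \<noteq> {}" "B \<noteq> {}" using 2 by auto
    have "rho G \<le> r" using half_join_eigenvalue_maximal(1)[OF G 2(1) ne H(2-4) z f] .
    then have "(real (n - 1))\<^sup>2 \<le> r\<^sup>2" using rn by (intro power_mono) auto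
    also have "\<dots> < (real (n - 1))\<^sup>2"
    proof -
      obtain b where "n = b + 3" using 2(4) by (metis add.commute le_Suc_ex)
      then have "(n - 2) * 1 + 1 * 1 + (n - 1) * (n - 2) = (n - 1)\<^sup>2"
        by (simp add: power2_eq_square algebra_simps)
      then show ?thesis using r(2) by (metis of_nat_power)
    qed
    finally show ?thesis by simp
  qed
qed

theorem theorem2p5:
  fixes G :: "'a bigraph" and k n :: nat
  assumes "n \<ge> (k + 1)^2"
    and "bipartite_graph G"
    and "nearly_balanced G"
    and "card (verts G) = 2 * n - 1"
    and "min_degree G \<ge> k"
  shows "(k \<ge> 1 \<and> rho G \<ge> rho (S_graph n k) \<longrightarrow> traceable G \<or> G \<cong>\<^sub>b S_graph n k) \<and>
         (k = 0 \<and> n \<ge> 2 \<and> rho G \<ge> rho (T_graph n 0) \<longrightarrow> traceable G \<or> G \<cong>\<^sub>b T_graph n 0)"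
proof -
  have n: "n \<ge> 1" using assms(1) by (simp add: power2_eq_square)
  have fin: "finite (Xpart G)" "finite (Ypart G)" and disj: "Xpart G \<inter> Ypart G = {}"
    using assms(2) by (auto simp: bipartite_graph_def)
  have sum: "card (Xpart G) + card (Ypart G) = 2 * n - 1"
    using assms(4) fin disj by (simp add: verts_def card_Un_disjoint)
  have deg: "k \<le> vertex_degree G v" if "v \<in> verts G" for v
  proof -
    have "min_degree G \<le> vertex_degree G v"
      unfolding min_degree_def using fin that by (intro Min_le) (auto simp: verts_def)
    then show ?thesis using assms(5) by simp
  qed
  \<comment> \<open>Either orientation of near balance reduces to the case that \<open>Xpart\<close>
    is the larger part, with \<open>n\<close> vertices.\<close>
  define G' where "G' = (if card (Xpart G) = n then G else swap_parts G)"
  have cG': "card (Xpart G') = n" "card (Ypart G') = n - 1"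
    using sum assms(3) n by (auto simp: G'_def nearly_balanced_def)
  have G': "bipartite_graph G'" using assms(2) by (simp add: G'_def bipartite_graph_swap_parts)
  have inv: "rho G' = rho G" "traceable G' = traceable G" "\<And>H. G' \<cong>\<^sub>b H \<longleftrightarrow> G \<cong>\<^sub>b H" for H
    by (simp_all add: G'_def swap_parts_invariants swap_parts_iso)
  have deg': "k \<le> vertex_degree G' v" if "v \<in> verts G'" for v
    using deg[of v] that by (simp add: G'_def swap_parts_invariants split: if_splits)
  show ?thesis
    using traceable_or_S_graph[OF G' cG' _ assms(1) deg'] traceable_or_T_graph[OF G' cG']
    unfolding inv by blast
qed

end
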